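(* Assume $\dim H = 1$ (equivalently $m=n-1$). Let $y^0,y^1\in\mathcal{C}^{\mathrm{o}}$, put $h_0 = P_H y^0$, $h_1 = P_H y^1$, and suppose $h_0\neq h_1$. (i) If $s(h,h_0,h_1)>0$ for all $h\in[h_0,h_1]$, then $T_{\mathcal{C}}(y^0,y^1)=\overline T_{\mathcal{C}}(y^0,y^1)<\infty$ and $$T_{\mathcal{C}}(y^0,y^1)=\int_{h\in[h_0,h_1]}\frac{dh}{s(h,h_0,h_1)}.$$ In particular, this integral is finite. (ii) If $s(h_2,h_0,h_1)\le 0$ for some $h_2\in[h_0,h_1]$, then $T_{\mathcal{C}}(y^0,y^1)=\overline T_{\mathcal{C}}(y^0,y^1)=\infty$.
   Context: Setting. Let $m<n$ be positive integers, $F:\mathbb{R}^n\to\mathbb{R}^n$ a Lipschitz vector field with Lipschitz constant $L_F>0$, $B$ a real $n\times m$ matrix of rank $m$, and $\mathcal{C}\subset\mathbb{R}^n$ a bounded convex set with nonempty interior $\mathcal{C}^{\mathrm{o}}$ and $C^1$ boundary. The control system is $$\dot y(t)=F(y(t))+Bu(t). \qquad ( * )$$ Solutions of all differential equations and inclusions are absolutely continuous functions satisfying the relation for almost every $t$. Notation. $H=(\mathrm{ran}\,B)^\perp$ is the orthogonal complement of the range of $B$ in $\mathbb{R}^n$ (so $\dim H=n-m$) and $H^\perp=\mathrm{ran}\,B$. $P_H$ is the orthogonal projection onto $H$, and $F_H(y):=P_HF(y)$; for a set $Q$, $F_H(Q)=\{F_H(x):x\in Q\}$. $[h_0,h_1]$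 is the closed segment joining $h_0$ and $h_1$, and $\int_{h\in[h_0,h_1]}\cdot\,dh$ denotes integration with respect to arc length on it. Measurable selection assumption. Let $\mathcal{D}_f$ be the set of $(h_1,h_2)\in H\times H$ such that for some $h^\perp\in H^\perp$ one has $h_1=F_H(h_2+h^\perp)$ and $h_2+h^\perp\in\mathcal{C}$. It is assumed that there is a Borel measurable map $f:\mathcal{D}_f\to H^\perp$ such that $h_1=F_H(h_2+f(h_1,h_2))$ and $h_2+f(h_1,h_2)\in\mathcal{C}$ for every $(h_1,h_2)\in\mathcal{D}_f$. Times (with $\inf\varnothing=+\infty$). For $y^0,y^1\in\mathcal{C}^{\mathrm{o}}$: - $T_{\mathcal{C}}(y^0,y^1)$ is the infimum of all $T>0$ for which there exist $u\in L^\infty([0,T],\mathbb{R}^m)$ and a solution $y$ of $( * )$ on $[0,T]$ with $y(0)=y^0$, $y(T)=y^1$ and $y(t)\in\mathcal{C}$ for all $t\in[0,T]$. - $\overline T_{\mathcal{C}}(y^0,y^1)$ is the infimum of all $T>0$ for which there exists $z:[0,T]\to H$ with $z(0)=P_Hy^0$, $z(T)=P_Hy^1$, $z(t)\in P_H\mathcal{C}$ for all $t\in[0,T]$, solving the differential inclusion $\dot z(t)\in F_H\big((z(t)+H^\perp)\cap\mathcal{C}\big)$. Speed. For $h,h_0,h_1\in H$ with $h_0\ne h_1$, $$s(h,h_0,h_1)=\frac{\sup\{\langle x,h_1-h_0\rangle : x\in F_H((h+H^\perp)\cap\mathcal{C})\}}{|h_1-h_0|}.$$ *)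

theory Defs
  imports "HOL-Analysis.Analysis"
begin

(* Textbook absolute continuity on [a, b].  The members of a division are finitely many compact
   intervals with pairwise disjoint interiors; the intervals need not cover [a, b]. *)
definition abs_continuous :: "real \<Rightarrow> real \<Rightarrow> (real \<Rightarrow> 'a::real_normed_vector) \<Rightarrow> bool" where
  "abs_continuous a b f \<longleftrightarrow>
    (\<forall>\<epsilon>>0. \<exists>\<delta>>0. \<forall>\<D> S. \<D> division_of S \<and> S \<subseteq> {a..b} \<and> (\<Sum>K\<in>\<D>. Sup K - Inf K) < \<delta>
       \<longrightarrow> (\<Sum>K\<in>\<D>. norm (f (Sup K) - f (Inf K))) < \<epsilon>)"

(* Local defining functions.  C need not be open or closed, so the inside is described through
   interior C. *)
definition C1_boundary :: "'a::euclidean_space set \<Rightarrow> bool" where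
  "C1_boundary C \<longleftrightarrow>
    (\<forall>p\<in>frontier C. \<exists>U g G. open U \<and> p \<in> U
       \<and> (\<forall>x\<in>U. (g has_derivative (\<lambda>v. G x \<bullet> v)) (at x)) \<and> continuous_on U G \<and> G p \<noteq> 0
       \<and> interior C \<inter> U = {x\<in>U. g x < (0::real)} \<and> frontier C \<inter> U = {x\<in>U. g x = 0})"

definition orth_proj :: "'a::euclidean_space set \<Rightarrow> 'a \<Rightarrow> 'a" where
  "orth_proj S y = (THE p. p \<in> S \<and> y - p \<in> S\<^sup>\<bottom>)"

definition Linfty_on :: "real \<Rightarrow> (real \<Rightarrow> 'a::euclidean_space) \<Rightarrow> bool" where
  "Linfty_on T u \<longleftrightarrow> u \<in> borel_measurable (lebesgue_on {0..T})
     \<and> (\<exists>K. AE t in lebesgue_on {0..T}. norm (u t) \<le> K)"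

definition H_space :: "real^'m^'n \<Rightarrow> (real^'n) set" where
  "H_space B = (range (\<lambda>u. B *v u))\<^sup>\<bottom>"

definition F_H :: "(real^'n \<Rightarrow> real^'n) \<Rightarrow> real^'m^'n \<Rightarrow> real^'n \<Rightarrow> real^'n" where
  "F_H F B y = orth_proj (H_space B) (F y)"

definition fibre :: "real^'m^'n \<Rightarrow> (real^'n) set \<Rightarrow> real^'n \<Rightarrow> (real^'n) set" where
  "fibre B C h = (\<lambda>k. h + k) ` ((H_space B)\<^sup>\<bottom>) \<inter> C"

definition D_f :: "(real^'n \<Rightarrow> real^'n) \<Rightarrow> real^'m^'n \<Rightarrow> (real^'n) set \<Rightarrow> ((real^'n) \<times> (real^'n)) set" where
  "D_f F B C = {(h\<^sub>1, h\<^sub>2). h\<^sub>1 \<in> H_space B \<and> h\<^sub>2 \<in> H_space B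
     \<and> (\<exists>k\<in>(H_space B)\<^sup>\<bottom>. h\<^sub>1 = F_H F B (h\<^sub>2 + k) \<and> h\<^sub>2 + k \<in> C)}"

definition measurable_selection :: "(real^'n \<Rightarrow> real^'n) \<Rightarrow> real^'m^'n \<Rightarrow> (real^'n) set \<Rightarrow> bool" where
  "measurable_selection F B C \<longleftrightarrow>
    (\<exists>f \<in> borel_measurable (restrict_space borel (D_f F B C)).
       \<forall>(h\<^sub>1, h\<^sub>2)\<in>D_f F B C. f (h\<^sub>1, h\<^sub>2) \<in> (H_space B)\<^sup>\<bottom>
         \<and> h\<^sub>1 = F_H F B (h\<^sub>2 + f (h\<^sub>1, h\<^sub>2)) \<and> h\<^sub>2 + f (h\<^sub>1, h\<^sub>2) \<in> C)"

definition control_solution ::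
  "(real^'n \<Rightarrow> real^'n) \<Rightarrow> real^'m^'n \<Rightarrow> real \<Rightarrow> (real \<Rightarrow> real^'m) \<Rightarrow> (real \<Rightarrow> real^'n) \<Rightarrow> bool" where
  "control_solution F B T u y \<longleftrightarrow> abs_continuous 0 T y
     \<and> (AE t in lebesgue_on {0..T}.
          (y has_vector_derivative (F (y t) + B *v u t)) (at t within {0..T}))"

definition inclusion_solution ::
  "(real^'n \<Rightarrow> real^'n) \<Rightarrow> real^'m^'n \<Rightarrow> (real^'n) set \<Rightarrow> real \<Rightarrow> (real \<Rightarrow> real^'n) \<Rightarrow> bool" where
  "inclusion_solution F B C T z \<longleftrightarrow> abs_continuous 0 T z
     \<and> (AE t in lebesgue_on {0..T}. \<exists>v \<in> F_H F B ` fibre B C (z t).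
          (z has_vector_derivative v) (at t within {0..T}))"

(* Times are ereal-valued, so that the infimum over the empty set is \<infinity>. *)
definition min_time ::
  "(real^'n \<Rightarrow> real^'n) \<Rightarrow> real^'m^'n \<Rightarrow> (real^'n) set \<Rightarrow> real^'n \<Rightarrow> real^'n \<Rightarrow> ereal" where
  "min_time F B C y\<^sub>0 y\<^sub>1 =
    (INF T \<in> {T. 0 < T \<and> (\<exists>u y. Linfty_on T u \<and> control_solution F B T u y
        \<and> y 0 = y\<^sub>0 \<and> y T = y\<^sub>1 \<and> (\<forall>t\<in>{0..T}. y t \<in> C))}. ereal T)"

definition reduced_min_time ::
  "(real^'n \<Rightarrow> real^'n) \<Rightarrow> real^'m^'n \<Rightarrow> (real^'n) set \<Rightarrow> real^'n \<Rightarrow> real^'n \<Rightarrow> ereal" where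
  "reduced_min_time F B C y\<^sub>0 y\<^sub>1 =
    (INF T \<in> {T. 0 < T \<and> (\<exists>z. (\<forall>t\<in>{0..T}. z t \<in> H_space B) \<and> inclusion_solution F B C T z
        \<and> z 0 = orth_proj (H_space B) y\<^sub>0 \<and> z T = orth_proj (H_space B) y\<^sub>1
        \<and> (\<forall>t\<in>{0..T}. z t \<in> orth_proj (H_space B) ` C))}. ereal T)"

(* A real supremum: it is meaningful for h in the projection of a bounded C (F continuous), where
   the set is nonempty and bounded; in particular for h on the segment joining the projections of
   two points of a bounded convex C. *)
definition speed ::
  "(real^'n \<Rightarrow> real^'n) \<Rightarrow> real^'m^'n \<Rightarrow> (real^'n) set \<Rightarrow> real^'n \<Rightarrow> real^'n \<Rightarrow> real^'n \<Rightarrow> real" where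
  "speed F B C h h\<^sub>0 h\<^sub>1 =
    (SUP x \<in> F_H F B ` fibre B C h. x \<bullet> (h\<^sub>1 - h\<^sub>0)) / norm (h\<^sub>1 - h\<^sub>0)"

(* Integration over the segment [a, b] via the arc length parametrization
   r \<mapsto> a + r (b - a) / |b - a|. *)
definition arclength_integrable :: "'a::euclidean_space \<Rightarrow> 'a \<Rightarrow> ('a \<Rightarrow> real) \<Rightarrow> bool" where
  "arclength_integrable a b g \<longleftrightarrow>
    set_integrable lborel {0..norm (b - a)} (\<lambda>r. g (a + r *\<^sub>R sgn (b - a)))"

definition arclength_integral :: "'a::euclidean_space \<Rightarrow> 'a \<Rightarrow> ('a \<Rightarrow> real) \<Rightarrow> real" where
  "arclength_integral a b g =
    set_lebesgue_integral lborel {0..norm (b - a)} (\<lambda>r. g (a + r *\<^sub>R sgn (b - a)))"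

end

theory Submission
  imports Defs
begin

text \<open>
  Let \<open>e\<close> be the unit vector of the line \<open>H\<close> that points from \<open>h\<^sub>0\<close> to \<open>h\<^sub>1\<close>, and put
  \<open>a = y\<^sub>0 \<bullet> e < b = y\<^sub>1 \<bullet> e\<close>. Since the controls act exactly in the directions orthogonal to \<open>e\<close>,
  they cannot change the component \<open>w = y \<bullet> e\<close> directly: along a trajectory \<open>w' = F y \<bullet> e\<close>, the
  \<^emph>\<open>rate\<close> of the current point. They can, however, move the point inside its slice
  \<open>{y \<in> C. y \<bullet> e = r}\<close> as fast as desired. So \<open>w\<close> can do no better than \<open>w' = \<sigma>(w)\<close>, where \<open>\<sigma> r\<close>
  is the supremum of the rate over the slice (the speed of the statement), and it can come
  arbitrarily close to that. The time needed is therefore \<open>\<integral> dr / \<sigma> r\<close> over \<open>[a, b]\<close> as long as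
  \<open>\<sigma>\<close> is positive there, and the passage is impossible otherwise.

  Slices. As \<open>C\<close> is convex and contains interior points a little below height \<open>a\<close> and a little above
  height \<open>b\<close>, a point of one slice slides to a nearby slice over a proportional distance. Hence
  \<open>\<sigma>\<close> is Lipschitz on \<open>[a, b]\<close> (lemma \<open>top_rate_lipschitz\<close>).

  Lower bound. A solution of the reduced inclusion gives an absolutely continuous \<open>w\<close> with
  \<open>w' \<le> \<sigma>(w)\<close> almost everywhere. If \<open>\<Phi>\<close> is an increasing potential with \<open>\<Phi>' \<sigma> \<le> 1\<close>, then \<open>\<Phi> \<circ> w\<close>
  grows at most with slope 1, so that the passage from \<open>a'\<close> to \<open>b'\<close> takes at least the time
  \<open>\<Phi> b' - \<Phi> a'\<close> (lemma \<open>reach_time_lower_bound\<close>). For positive \<open>\<sigma>\<close> a primitive of \<open>1 / \<sigma>\<close>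
  gives the integral. If \<open>\<sigma> r\<^sub>2 \<le> 0\<close>, the Lipschitz bound \<open>\<sigma> r \<le> K |r - r\<^sub>2|\<close> allows logarithmic
  potentials, whose increments exceed every finite time. The same bounds hold for the control
  system, because the projection of an admissible trajectory solves the reduced inclusion.

  Upper bound. It takes an arbitrarily short time to steer a point to the vicinity of another interior
  point of its slice, by a large constant control, and, reversing time, to be steered into a given
  interior point from the vicinity of another one. Between these two manoeuvres the state follows
  a straight segment along which the rate is nearly \<open>\<sigma>\<close>; the height on the segment solves a
  scalar differential equation. This covers a short distance in \<open>H\<close> within \<open>1 + \<kappa>\<close> times the optimal
  time (lemma \<open>steers_short_distance\<close>), and these pieces are chained along the segment from \<open>y\<^sub>0\<close>
  to \<open>y\<^sub>1\<close> (lemma \<open>steers_in_nearly_optimal_time\<close>).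
\<close>

section \<open>Absolutely continuous functions\<close>

text \<open>A fine tagged division of the interval splits into pieces whose tag lies outside the null set,
  where the derivative controls the increment, and pieces whose tag lies in it. The latter
  are contained in an open set of small measure, hence have small total length, and absolute
  continuity makes their total increment small.\<close>
lemma abs_continuous_increment_le:
  fixes f :: "real \<Rightarrow> real"
  assumes "a \<le> b" and ac: "abs_continuous a b f" and "negligible N" and "0 \<le> c"
    and deriv: "\<And>t. t \<in> {a..b} - N \<Longrightarrow> \<exists>d\<le>c. (f has_real_derivative d) (at t within {a..b})"
  shows "f b - f a \<le> c * (b - a)"
proof (rule field_le_epsilon)
  fix \<epsilon>' :: real assume "0 < \<epsilon>'"
  define \<epsilon> where "\<epsilon> = \<epsilon>' / (b - a + 1)"
  have "0 < \<epsilon>" using \<open>0 < \<epsilon>'\<close> \<open>a \<le> b\<close> by (simp add: \<epsilon>_def)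
  then obtain \<delta> where "0 < \<delta>" and \<delta>: "\<And>\<D> S. \<lbrakk>\<D> division_of S; S \<subseteq> {a..b};
      (\<Sum>K\<in>\<D>. Sup K - Inf K) < \<delta>\<rbrakk> \<Longrightarrow> (\<Sum>K\<in>\<D>. norm (f (Sup K) - f (Inf K))) < \<epsilon>"
    using ac unfolding abs_continuous_def by meson
  obtain U where "open U" "N \<subseteq> U" and U: "U - N \<in> lmeasurable" "emeasure lebesgue (U - N) < ennreal \<delta>"
    using sets_lebesgue_outer_open[of N \<delta>] \<open>negligible N\<close> \<open>0 < \<delta>\<close> negligible_imp_sets by blast
  have "N \<in> null_sets lebesgue" using \<open>negligible N\<close> negligible_iff_null_sets by blast
  then have "emeasure lebesgue (U - N \<union> N) = emeasure lebesgue (U - N)"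
    using U(1) by (intro emeasure_Un_null_set) auto
  then have emU: "emeasure lebesgue U < ennreal \<delta>"
    using U(2) \<open>N \<subseteq> U\<close> by (simp add: Un_absorb2)
  have U_lm: "U \<in> lmeasurable"
    using fmeasurable.Un[OF U(1) negligible_imp_measurable[OF \<open>negligible N\<close>]] \<open>N \<subseteq> U\<close>
    by (simp add: Un_absorb2)
  have mU: "measure lebesgue U < \<delta>"
    using emU \<open>0 < \<delta>\<close> U_lm by (simp add: emeasure_eq_measure2 ennreal_less_iff)
  have "\<exists>r>0. (t \<in> {a..b} - N \<longrightarrow> (\<forall>u v. {u, v} \<subseteq> {a..b} \<and> {u, v} \<subseteq> ball t r \<and> u \<le> t \<and> t \<le> v
        \<longrightarrow> f v - f u \<le> (c + \<epsilon>) * (v - u))) \<and> (t \<in> N \<longrightarrow> ball t r \<subseteq> U)" for t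
  proof (cases "t \<in> {a..b} - N")
    case True
    then obtain d where "d \<le> c" and d: "(f has_real_derivative d) (at t within {a..b})"
      using deriv by blast
    then obtain r where "0 < r" and r: "\<And>y. y \<in> {a..b} \<Longrightarrow> norm (y - t) < r
        \<Longrightarrow> norm (f y - f t - d * (y - t)) \<le> \<epsilon> * norm (y - t)"
      using \<open>0 < \<epsilon>\<close> unfolding has_field_derivative_def has_derivative_within_alt by metis
    have "f v - f u \<le> (c + \<epsilon>) * (v - u)"
      if "{u, v} \<subseteq> {a..b}" "{u, v} \<subseteq> ball t r" "u \<le> t" "t \<le> v" for u v
    proof -
      have "norm (f v - f t - d * (v - t)) \<le> \<epsilon> * (v - t)" "norm (f u - f t - d * (u - t)) \<le> \<epsilon> * (t - u)"
        using r[of v] r[of u] that by (auto simp: dist_real_def)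
      then have "f v - f u \<le> d * (v - u) + \<epsilon> * (v - u)"
        by (simp add: algebra_simps abs_le_iff)
      also have "\<dots> \<le> c * (v - u) + \<epsilon> * (v - u)"
        using \<open>d \<le> c\<close> that by (auto intro: mult_right_mono)
      finally show ?thesis by (simp add: algebra_simps)
    qed
    then show ?thesis using True \<open>0 < r\<close> by blast
  next
    case False
    show ?thesis
    proof (cases "t \<in> N")
      case True
      then show ?thesis using False \<open>open U\<close> \<open>N \<subseteq> U\<close> by (meson openE subsetD)
    qed (use False in \<open>auto intro: exI[of _ 1]\<close>)
  qed
  then obtain r where r: "\<And>t. 0 < r t"
    and good: "\<And>t u v. \<lbrakk>t \<in> {a..b} - N; {u, v} \<subseteq> {a..b}; {u, v} \<subseteq> ball t (r t); u \<le> t; t \<le> v\<rbrakk>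
        \<Longrightarrow> f v - f u \<le> (c + \<epsilon>) * (v - u)"
    and bad: "\<And>t. t \<in> N \<Longrightarrow> ball t (r t) \<subseteq> U"
    by metis
  have "gauge (\<lambda>t. ball t (r t))" using r by (rule gauge_ball_dependent[rule_format])
  then obtain p where p: "p tagged_division_of {a..b}" and fine: "(\<lambda>t. ball t (r t)) fine p"
    by (rule fine_division_exists_real)
  have fin: "finite p" using p by (rule tagged_division_of_finite)
  have piece: "\<exists>u v. K = {u..v} \<and> u \<le> t \<and> t \<le> v \<and> a \<le> u \<and> v \<le> b \<and> {u..v} \<subseteq> ball t (r t)
      \<and> Sup K = v \<and> Inf K = u" if tK: "(t, K) \<in> p" for t K
  proof -
    obtain u v where "K = cbox u v" using tagged_division_ofD(4)[OF p tK] by blast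
    moreover have "t \<in> K" "K \<subseteq> {a..b}" using tagged_division_ofD(2,3)[OF p tK] .
    moreover have "K \<subseteq> ball t (r t)" using fineD[OF fine tK] .
    ultimately show ?thesis by (intro exI[of _ u] exI[of _ v]) auto
  qed
  \<comment> \<open>The pieces on which nothing is known about the derivative of f.\<close>
  define q where "q = {(t, K) \<in> p. t \<in> N}"
  have q_sub: "q \<subseteq> p" by (auto simp: q_def)
  have q: "q tagged_division_of \<Union>(snd ` q)"
    using tagged_partial_division_of_Union_self tagged_partial_division_subset[OF _ q_sub] p
    by (metis tagged_division_of_def)
  then have div: "snd ` q division_of \<Union>(snd ` q)" by (rule division_of_tagged_division)
  have "\<Union>(snd ` q) \<subseteq> {a..b} \<inter> U"
  proof -
    have "K \<subseteq> {a..b} \<inter> U" if "(t, K) \<in> q" for t K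
      using that piece[of t K] bad[of t] q_sub by (fastforce simp: q_def)
    then show ?thesis by force
  qed
  have "(\<Sum>K\<in>snd ` q. Sup K - Inf K) = (\<Sum>K\<in>snd ` q. measure lebesgue K)"
  proof (rule sum.cong[OF refl])
    fix K assume "K \<in> snd ` q"
    then obtain t where "(t, K) \<in> p" using q_sub by force
    then show "Sup K - Inf K = measure lebesgue K" using piece[of t K] by fastforce
  qed
  also have "\<dots> = measure lebesgue (\<Union>(snd ` q))" using content_division[OF div] .
  also have "\<dots> \<le> measure lebesgue U"
    using lmeasurable_division[OF div] U_lm \<open>\<Union>(snd ` q) \<subseteq> {a..b} \<inter> U\<close>
    by (intro measure_mono_fmeasurable) auto
  finally have "(\<Sum>K\<in>snd ` q. norm (f (Sup K) - f (Inf K))) < \<epsilon>"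
    using \<delta>[OF div] mU \<open>\<Union>(snd ` q) \<subseteq> {a..b} \<inter> U\<close> by auto
  moreover have "(\<Sum>(t, K)\<in>q. norm (f (Sup K) - f (Inf K))) = (\<Sum>K\<in>snd ` q. norm (f (Sup K) - f (Inf K)))"
  proof -
    \<comment> \<open>Distinct tags may belong to the same degenerate interval, so that the two sums range over
      different index sets; such an interval contributes nothing.\<close>
    let ?d = "\<lambda>K. if K = {} then 0 else norm (f (Sup K) - f (Inf K))"
    have nonempty: "K \<noteq> {}" if "(t, K) \<in> q" for t K
      using that q_sub piece[of t K] by fastforce
    have "(\<Sum>(t, K)\<in>q. norm (f (Sup K) - f (Inf K))) = (\<Sum>(t, K)\<in>q. ?d K)"
      using nonempty by (intro sum.cong) auto
    also have "\<dots> = sum ?d (snd ` q)"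
    proof (rule sum.over_tagged_division_lemma[OF q])
      fix u v :: real assume "box u v = {}"
      then have "cbox u v = {} \<or> u = v" by auto
      then show "?d (cbox u v) = 0" by (cases "cbox u v = {}") auto
    qed
    also have "\<dots> = (\<Sum>K\<in>snd ` q. norm (f (Sup K) - f (Inf K)))"
      using nonempty by (intro sum.cong) auto
    finally show ?thesis .
  qed
  moreover have "(\<Sum>(t, K)\<in>q. f (Sup K) - f (Inf K)) \<le> (\<Sum>(t, K)\<in>q. norm (f (Sup K) - f (Inf K)))"
    by (rule sum_mono) auto
  ultimately have q_le: "(\<Sum>(t, K)\<in>q. f (Sup K) - f (Inf K)) \<le> \<epsilon>" by linarith
  have "(\<Sum>(t, K)\<in>p - q. f (Sup K) - f (Inf K)) \<le> (\<Sum>(t, K)\<in>p - q. (c + \<epsilon>) * (Sup K - Inf K))"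
  proof (rule sum_mono, clarify)
    fix t K assume K: "(t, K) \<in> p" "(t, K) \<notin> q"
    then have "t \<notin> N" by (auto simp: q_def)
    obtain u v where uv: "u \<le> t" "t \<le> v" "a \<le> u" "v \<le> b" "{u..v} \<subseteq> ball t (r t)"
      and "Sup K = v" "Inf K = u"
      using piece[OF K(1)] by blast
    moreover have "f v - f u \<le> (c + \<epsilon>) * (v - u)"
    proof (rule good)
      show "{u, v} \<subseteq> ball t (r t)" using uv by fastforce
    qed (use uv \<open>t \<notin> N\<close> in auto)
    ultimately show "f (Sup K) - f (Inf K) \<le> (c + \<epsilon>) * (Sup K - Inf K)" by simp
  qed
  also have "\<dots> \<le> (\<Sum>(t, K)\<in>p. (c + \<epsilon>) * (Sup K - Inf K))"
  proof (rule sum_mono2[OF fin])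
    show "0 \<le> (case x of (t, K) \<Rightarrow> (c + \<epsilon>) * (Sup K - Inf K))" if "x \<in> p - (p - q)" for x
      using that q_sub piece \<open>0 \<le> c\<close> \<open>0 < \<epsilon>\<close> by (cases x) (fastforce intro!: mult_nonneg_nonneg)
  qed auto
  also have "\<dots> = (c + \<epsilon>) * (\<Sum>(t, K)\<in>p. Sup K - Inf K)"
    by (simp add: sum_distrib_left case_prod_unfold)
  also have "(\<Sum>(t, K)\<in>p. Sup K - Inf K) = b - a"
    using additive_tagged_division_1[OF \<open>a \<le> b\<close> p, of "\<lambda>x. x"] by simp
  finally have "(\<Sum>(t, K)\<in>p - q. f (Sup K) - f (Inf K)) \<le> (c + \<epsilon>) * (b - a)" .
  moreover have "f b - f a = (\<Sum>(t, K)\<in>p - q. f (Sup K) - f (Inf K)) + (\<Sum>(t, K)\<in>q. f (Sup K) - f (Inf K))"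
    using additive_tagged_division_1[OF \<open>a \<le> b\<close> p, of f] sum.subset_diff[OF q_sub fin] by metis
  ultimately have "f b - f a \<le> c * (b - a) + \<epsilon> * (b - a + 1)"
    using q_le by (simp add: algebra_simps)
  then show "f b - f a \<le> c * (b - a) + \<epsilon>'"
    using \<open>a \<le> b\<close> by (simp add: \<epsilon>_def)
qed

lemma lipschitz_imp_abs_continuous:
  fixes f :: "real \<Rightarrow> 'a::real_normed_vector"
  assumes "L-lipschitz_on {a..b} f"
  shows "abs_continuous a b f"
  unfolding abs_continuous_def
proof (intro allI impI)
  fix \<epsilon> :: real assume "0 < \<epsilon>"
  have "0 \<le> L" using assms by (rule lipschitz_on_nonneg)
  show "\<exists>\<delta>>0. \<forall>\<D> S. \<D> division_of S \<and> S \<subseteq> {a..b} \<and> (\<Sum>K\<in>\<D>. Sup K - Inf K) < \<delta>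
       \<longrightarrow> (\<Sum>K\<in>\<D>. norm (f (Sup K) - f (Inf K))) < \<epsilon>"
  proof (intro exI[of _ "\<epsilon> / (L + 1)"] conjI allI impI)
    show "0 < \<epsilon> / (L + 1)" using \<open>0 < \<epsilon>\<close> \<open>0 \<le> L\<close> by simp
    fix \<D> S assume D: "\<D> division_of S \<and> S \<subseteq> {a..b} \<and> (\<Sum>K\<in>\<D>. Sup K - Inf K) < \<epsilon> / (L + 1)"
    have K: "norm (f (Sup K) - f (Inf K)) \<le> L * (Sup K - Inf K) \<and> 0 \<le> Sup K - Inf K" if "K \<in> \<D>" for K
    proof -
      have "\<D> division_of S" "S \<subseteq> {a..b}" using D by auto
      then have "K \<noteq> {}" "K \<subseteq> {a..b}" and "\<exists>u v. K = cbox u v"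
        using division_ofD(2-4)[OF _ that] by blast+
      then obtain u v where "K = cbox u v" "K \<noteq> {}" "K \<subseteq> {a..b}" by blast
      then show ?thesis
        using lipschitz_on_normD[OF assms, of v u] by (auto simp: dist_real_def)
    qed
    then have "(\<Sum>K\<in>\<D>. norm (f (Sup K) - f (Inf K))) \<le> L * (\<Sum>K\<in>\<D>. Sup K - Inf K)"
      unfolding sum_distrib_left by (intro sum_mono) auto
    also have "\<dots> \<le> (L + 1) * (\<Sum>K\<in>\<D>. Sup K - Inf K)"
      using K by (intro mult_right_mono sum_nonneg) auto
    also have "\<dots> < \<epsilon>" using D \<open>0 \<le> L\<close> by (simp add: field_simps)
    finally show "(\<Sum>K\<in>\<D>. norm (f (Sup K) - f (Inf K))) < \<epsilon>" .
  qed
qed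

lemma abs_continuous_subinterval:
  assumes "abs_continuous a b f" "a \<le> a'" "b' \<le> b"
  shows "abs_continuous a' b' f"
  unfolding abs_continuous_def
proof (intro allI impI)
  fix \<epsilon> :: real assume "0 < \<epsilon>"
  have "{a'..b'} \<subseteq> {a..b}" using assms by auto
  then show "\<exists>\<delta>>0. \<forall>\<D> S. \<D> division_of S \<and> S \<subseteq> {a'..b'} \<and> (\<Sum>K\<in>\<D>. Sup K - Inf K) < \<delta>
       \<longrightarrow> (\<Sum>K\<in>\<D>. norm (f (Sup K) - f (Inf K))) < \<epsilon>"
    using assms(1) \<open>0 < \<epsilon>\<close> unfolding abs_continuous_def by (meson order_trans)
qed

lemma abs_continuous_compose_lipschitz:
  fixes f :: "real \<Rightarrow> 'a::real_normed_vector" and g :: "'a \<Rightarrow> 'b::real_normed_vector"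
  assumes "abs_continuous a b f" and g: "L-lipschitz_on X g" and "f ` {a..b} \<subseteq> X"
  shows "abs_continuous a b (\<lambda>t. g (f t))"
  unfolding abs_continuous_def
proof (intro allI impI)
  fix \<epsilon> :: real assume "0 < \<epsilon>"
  have "0 \<le> L" using g by (rule lipschitz_on_nonneg)
  then have "0 < \<epsilon> / (L + 1)" using \<open>0 < \<epsilon>\<close> by simp
  then obtain \<delta> where "0 < \<delta>" and \<delta>: "\<And>\<D> S. \<lbrakk>\<D> division_of S; S \<subseteq> {a..b};
      (\<Sum>K\<in>\<D>. Sup K - Inf K) < \<delta>\<rbrakk> \<Longrightarrow> (\<Sum>K\<in>\<D>. norm (f (Sup K) - f (Inf K))) < \<epsilon> / (L + 1)"
    using assms(1) unfolding abs_continuous_def by meson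
  have "(\<Sum>K\<in>\<D>. norm (g (f (Sup K)) - g (f (Inf K)))) < \<epsilon>"
    if D: "\<D> division_of S" "S \<subseteq> {a..b}" "(\<Sum>K\<in>\<D>. Sup K - Inf K) < \<delta>" for \<D> S
  proof -
    have "norm (g (f (Sup K)) - g (f (Inf K))) \<le> L * norm (f (Sup K) - f (Inf K))" if "K \<in> \<D>" for K
    proof -
      have "\<D> division_of S" "S \<subseteq> {a..b}" using D by auto
      then have "K \<noteq> {}" "K \<subseteq> {a..b}" and "\<exists>u v. K = cbox u v"
        using division_ofD(2-4)[OF _ that] by blast+
      then obtain u v where "K = cbox u v" "K \<noteq> {}" "K \<subseteq> {a..b}" by blast
      moreover from this have "u \<in> {a..b}" "v \<in> {a..b}" by auto
      then have "f u \<in> X" "f v \<in> X" using assms(3) by blast+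
      ultimately show ?thesis
        using lipschitz_on_normD[OF g, of "f v" "f u"] by auto
    qed
    then have "(\<Sum>K\<in>\<D>. norm (g (f (Sup K)) - g (f (Inf K)))) \<le> L * (\<Sum>K\<in>\<D>. norm (f (Sup K) - f (Inf K)))"
      unfolding sum_distrib_left by (intro sum_mono) auto
    also have "\<dots> \<le> (L + 1) * (\<Sum>K\<in>\<D>. norm (f (Sup K) - f (Inf K)))"
      by (intro mult_right_mono sum_nonneg) auto
    also have "\<dots> < \<epsilon>" using \<delta>[OF D] \<open>0 \<le> L\<close> by (simp add: field_simps)
    finally show ?thesis .
  qed
  then show "\<exists>\<delta>>0. \<forall>\<D> S. \<D> division_of S \<and> S \<subseteq> {a..b} \<and> (\<Sum>K\<in>\<D>. Sup K - Inf K) < \<delta>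
       \<longrightarrow> (\<Sum>K\<in>\<D>. norm (g (f (Sup K)) - g (f (Inf K)))) < \<epsilon>"
    using \<open>0 < \<delta>\<close> by blast
qed

lemma abs_continuous_imp_continuous_on:
  assumes "abs_continuous a b f"
  shows "continuous_on {a..b} f"
  unfolding continuous_on_iff
proof (intro ballI allI impI)
  fix s \<epsilon> :: real assume s: "s \<in> {a..b}" and "0 < \<epsilon>"
  then obtain \<delta> where "0 < \<delta>" and \<delta>: "\<And>\<D> S. \<lbrakk>\<D> division_of S; S \<subseteq> {a..b};
      (\<Sum>K\<in>\<D>. Sup K - Inf K) < \<delta>\<rbrakk> \<Longrightarrow> (\<Sum>K\<in>\<D>. norm (f (Sup K) - f (Inf K))) < \<epsilon>"
    using assms unfolding abs_continuous_def by meson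
  have close: "norm (f v - f u) < \<epsilon>" if "u \<in> {a..b}" "v \<in> {a..b}" "u \<le> v" "v - u < \<delta>" for u v
    using \<delta>[OF division_of_self[of u v]] that by auto
  have "dist (f t) (f s) < \<epsilon>" if "t \<in> {a..b}" "dist t s < \<delta>" for t
    using close[of s t] close[of t s] s that
    by (cases "s \<le> t") (auto simp: dist_norm norm_minus_commute)
  then show "\<exists>\<delta>>0. \<forall>t\<in>{a..b}. dist t s < \<delta> \<longrightarrow> dist (f t) (f s) < \<epsilon>"
    using \<open>0 < \<delta>\<close> by blast
qed

text \<open>Take the first time at which the level \<open>b\<close> is reached, and before it the last time at level \<open>a\<close>.
  Between them the path stays in \<open>[a, b]\<close>, the range in which its speed can be estimated.\<close>
lemma crossing_interval:
  fixes w :: "real \<Rightarrow> real"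
  assumes "0 \<le> T" and cont: "continuous_on {0..T} w" and "w 0 \<le> a" "a \<le> b" "b \<le> w T"
  obtains t\<^sub>1 t\<^sub>2 where "0 \<le> t\<^sub>1" "t\<^sub>1 \<le> t\<^sub>2" "t\<^sub>2 \<le> T" "w t\<^sub>1 = a" "w t\<^sub>2 = b" "w ` {t\<^sub>1..t\<^sub>2} \<subseteq> {a..b}"
proof -
  have "closed {t \<in> {0..T}. b \<le> w t}"
    using cont by (intro continuous_on_closed_Collect_le continuous_intros) auto
  then have "compact {t \<in> {0..T}. b \<le> w t}"
    by (intro compact_eq_bounded_closed[THEN iffD2] conjI bounded_subset[OF bounded_closed_interval[of 0 T]]) auto
  moreover have "T \<in> {t \<in> {0..T}. b \<le> w t}" using assms by auto
  ultimately obtain t\<^sub>2 where t\<^sub>2: "t\<^sub>2 \<in> {0..T}" "b \<le> w t\<^sub>2" and first: "\<And>t. \<lbrakk>t \<in> {0..T}; b \<le> w t\<rbrakk> \<Longrightarrow> t\<^sub>2 \<le> t"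
    using compact_attains_inf[of "{t \<in> {0..T}. b \<le> w t}"] by blast
  have "continuous_on {0..t\<^sub>2} w" using cont t\<^sub>2 by (auto intro: continuous_on_subset)
  then obtain t where "0 \<le> t" "t \<le> t\<^sub>2" "w t = b"
    using IVT'[of w 0 b t\<^sub>2] t\<^sub>2 assms by auto
  then have "w t\<^sub>2 = b" using first[of t] t\<^sub>2 by auto
  have "closed {t \<in> {0..t\<^sub>2}. w t \<le> a}"
    using \<open>continuous_on {0..t\<^sub>2} w\<close> by (intro continuous_on_closed_Collect_le continuous_intros) auto
  then have "compact {t \<in> {0..t\<^sub>2}. w t \<le> a}"
    by (intro compact_eq_bounded_closed[THEN iffD2] conjI bounded_subset[OF bounded_closed_interval[of 0 t\<^sub>2]]) auto
  moreover have "0 \<in> {t \<in> {0..t\<^sub>2}. w t \<le> a}" using assms t\<^sub>2 by auto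
  ultimately obtain t\<^sub>1 where t\<^sub>1: "t\<^sub>1 \<in> {0..t\<^sub>2}" "w t\<^sub>1 \<le> a" and last: "\<And>t. \<lbrakk>t \<in> {0..t\<^sub>2}; w t \<le> a\<rbrakk> \<Longrightarrow> t \<le> t\<^sub>1"
    using compact_attains_sup[of "{t \<in> {0..t\<^sub>2}. w t \<le> a}"] by blast
  have "continuous_on {t\<^sub>1..t\<^sub>2} w" using cont t\<^sub>1 t\<^sub>2 by (auto intro: continuous_on_subset)
  then obtain t where "t\<^sub>1 \<le> t" "t \<le> t\<^sub>2" "w t = a"
    using IVT'[of w t\<^sub>1 a t\<^sub>2] t\<^sub>1 \<open>w t\<^sub>2 = b\<close> \<open>a \<le> b\<close> by auto
  then have "w t\<^sub>1 = a" using last[of t] t\<^sub>1 by auto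
  have "w t \<in> {a..b}" if "t \<in> {t\<^sub>1..t\<^sub>2}" for t
  proof -
    have "w t \<le> b"
    proof (cases "t = t\<^sub>2")
      case False
      then show ?thesis using first[of t] that t\<^sub>1 t\<^sub>2 by force
    qed (use \<open>w t\<^sub>2 = b\<close> in simp)
    moreover have "a \<le> w t"
    proof (cases "t = t\<^sub>1")
      case False
      then show ?thesis using last[of t] that t\<^sub>1 t\<^sub>2 by force
    qed (use \<open>w t\<^sub>1 = a\<close> in simp)
    ultimately show ?thesis by simp
  qed
  then have "w ` {t\<^sub>1..t\<^sub>2} \<subseteq> {a..b}" by blast
  then show thesis using that[of t\<^sub>1 t\<^sub>2] t\<^sub>1 t\<^sub>2 \<open>w t\<^sub>1 = a\<close> \<open>w t\<^sub>2 = b\<close> by auto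
qed

text \<open>Along a path with speed at most \<open>\<sigma>\<close>, the potential \<open>\<Phi>\<close> grows with slope at most 1 as long as the
  path stays in \<open>[a, b]\<close>, so its increment over a crossing is a lower bound on the elapsed time.
  Different choices of \<open>\<Phi>\<close> yield the exact time and the impossibility of the passage.\<close>
lemma reach_time_lower_bound:
  fixes w :: "real \<Rightarrow> real"
  assumes "0 \<le> T" and ac: "abs_continuous 0 T w" and "w 0 \<le> a" "a \<le> b" "b \<le> w T"
    and N: "negligible N"
    and deriv: "\<And>t. t \<in> {0..T} - N \<Longrightarrow> \<exists>d\<le>\<sigma> (w t). (w has_real_derivative d) (at t within {0..T})"
    and \<Phi>: "\<And>r. r \<in> {a..b} \<Longrightarrow> (\<Phi> has_real_derivative \<phi> r) (at r within {a..b})"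
    and \<phi>: "continuous_on {a..b} \<phi>" "\<And>r. r \<in> {a..b} \<Longrightarrow> 0 \<le> \<phi> r" "\<And>r. r \<in> {a..b} \<Longrightarrow> \<phi> r * \<sigma> r \<le> 1"
  shows "\<Phi> b - \<Phi> a \<le> T"
proof -
  have cont: "continuous_on {0..T} w" using ac by (rule abs_continuous_imp_continuous_on)
  obtain t\<^sub>1 t\<^sub>2 where t: "0 \<le> t\<^sub>1" "t\<^sub>1 \<le> t\<^sub>2" "t\<^sub>2 \<le> T" and w: "w t\<^sub>1 = a" "w t\<^sub>2 = b" "w ` {t\<^sub>1..t\<^sub>2} \<subseteq> {a..b}"
    using crossing_interval[OF \<open>0 \<le> T\<close> cont \<open>w 0 \<le> a\<close> \<open>a \<le> b\<close> \<open>b \<le> w T\<close>] by blast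
  obtain M where M: "\<And>r. r \<in> {a..b} \<Longrightarrow> norm (\<phi> r) \<le> M"
    using compact_imp_bounded[OF compact_continuous_image[OF \<phi>(1)]] unfolding bounded_iff by blast
  have "\<bar>M\<bar>-lipschitz_on {a..b} \<Phi>"
  proof (rule lipschitz_onI)
    fix r s assume "r \<in> {a..b}" "s \<in> {a..b}"
    then show "dist (\<Phi> r) (\<Phi> s) \<le> \<bar>M\<bar> * dist r s"
      using field_differentiable_bound[OF _ \<Phi>, of "\<bar>M\<bar>" r s] M by (force simp: dist_norm)
  qed simp
  then have "abs_continuous t\<^sub>1 t\<^sub>2 (\<lambda>t. \<Phi> (w t))"
    using abs_continuous_compose_lipschitz[OF abs_continuous_subinterval[OF ac t(1,3)]] w(3) by blast
  then have "\<Phi> (w t\<^sub>2) - \<Phi> (w t\<^sub>1) \<le> 1 * (t\<^sub>2 - t\<^sub>1)"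
  proof (rule abs_continuous_increment_le[OF t(2) _ N])
    fix t assume "t \<in> {t\<^sub>1..t\<^sub>2} - N"
    then have "t \<in> {0..T} - N" and wt: "w t \<in> {a..b}"
      using t image_subset_iff[THEN iffD1, OF w(3)] by auto
    then obtain d where d: "d \<le> \<sigma> (w t)" "(w has_real_derivative d) (at t within {0..T})"
      using deriv by blast
    have "(w has_real_derivative d) (at t within {t\<^sub>1..t\<^sub>2})"
      using d(2) t by (auto intro: has_field_derivative_subset)
    moreover have "(\<Phi> has_real_derivative \<phi> (w t)) (at (w t) within w ` {t\<^sub>1..t\<^sub>2})"
      using \<Phi>[OF wt] w(3) by (rule has_field_derivative_subset)
    ultimately have "((\<lambda>t. \<Phi> (w t)) has_real_derivative \<phi> (w t) * d) (at t within {t\<^sub>1..t\<^sub>2})"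
      by (rule DERIV_image_chain[unfolded comp_def, rotated])
    moreover have "\<phi> (w t) * d \<le> 1"
      using mult_left_mono[OF d(1) \<phi>(2)[OF wt]] \<phi>(3)[OF wt] by linarith
    ultimately show "\<exists>d\<le>1. ((\<lambda>t. \<Phi> (w t)) has_real_derivative d) (at t within {t\<^sub>1..t\<^sub>2})" by blast
  qed simp
  then show ?thesis using w t by simp
qed

section \<open>Ordinary differential equations with a Lipschitz right-hand side\<close>

text \<open>Picard iteration in a weighted supremum norm. With the substitution
  \<open>x t = exp (l t) z t\<close> the integral operator contracts by \<open>L / l\<close> in the ordinary supremum norm of
  \<open>z\<close>, whatever the length of the time interval, so that no gluing of short solutions is needed.\<close>
lemma autonomous_ode_solution_exists:
  fixes X :: "'a::euclidean_space \<Rightarrow> 'a"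
  assumes lip: "L-lipschitz_on UNIV X" and "0 \<le> T"
  shows "\<exists>x. x 0 = x\<^sub>0 \<and> (\<forall>t\<in>{0..T}. (x has_vector_derivative X (x t)) (at t within {0..T}))"
proof -
  have "0 \<le> L" using lip by (rule lipschitz_on_nonneg)
  \<comment> \<open>The weight: any constant above L would do; this one gives the contraction factor 1/2 and is
    positive even if L = 0.\<close>
  define l where "l = 2 * L + 1"
  have "0 < l" "L / l \<le> 1/2" using \<open>0 \<le> L\<close> by (auto simp: l_def field_simps)
  define P where "P z t = exp (- l * t) *\<^sub>R (x\<^sub>0 + integral {0..t} (\<lambda>s. X (exp (l * s) *\<^sub>R apply_bcontfun z s)))"
    for z and t :: real
  have cont_X: "continuous_on S (\<lambda>s. X (exp (l * s) *\<^sub>R apply_bcontfun z s))" for S z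
    by (rule continuous_on_compose2[OF lipschitz_on_continuous_on[OF lip]]) (auto intro!: continuous_intros)
  have "continuous_on {0..T} (P z)" for z
    unfolding P_def
    by (intro continuous_intros indefinite_integral_continuous_1 integrable_continuous_real cont_X)
  then have "(\<lambda>t. P z (clamp 0 T t)) \<in> bcontfun" for z
    using clamp_continuous_on[of 0 T "P z"] clamp_bounded[of "P z" 0 T]
      compact_imp_bounded[OF compact_continuous_image[of "{0..T}" "P z"]] \<open>0 \<le> T\<close>
    by (auto simp: bcontfun_def)
  then have Q: "apply_bcontfun (Bcontfun (\<lambda>t. P z (clamp 0 T t))) = (\<lambda>t. P z (clamp 0 T t))" for z
    by (rule Bcontfun_inverse)
  have contr: "dist (P z t) (P z' t) \<le> 1/2 * dist z z'" if "0 \<le> t" for z z' t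
  proof -
    let ?D = "dist z z'"
    let ?f = "\<lambda>z s. X (exp (l * s) *\<^sub>R apply_bcontfun z s)"
    have int: "?f z integrable_on {0..t}" for z
      by (rule integrable_continuous_real[OF cont_X])
    have "((\<lambda>s. L * ?D * exp (l * s)) has_integral (L * ?D * exp (l * t) / l - L * ?D * exp (l * 0) / l)) {0..t}"
      using \<open>0 \<le> t\<close> \<open>0 < l\<close>
      by (intro fundamental_theorem_of_calculus)
        (auto intro!: derivative_eq_intros simp: has_real_derivative_iff_has_vector_derivative[symmetric])
    note I = this
    have "norm (?f z s - ?f z' s) \<le> L * ?D * exp (l * s)" for s
    proof -
      have "norm (?f z s - ?f z' s) \<le> L * norm (exp (l * s) *\<^sub>R apply_bcontfun z s - exp (l * s) *\<^sub>R apply_bcontfun z' s)"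
        using lipschitz_on_normD[OF lip] by simp
      also have "\<dots> = L * (exp (l * s) * dist (apply_bcontfun z s) (apply_bcontfun z' s))"
        by (simp add: scaleR_diff_right[symmetric] dist_norm)
      also have "\<dots> \<le> L * (exp (l * s) * ?D)"
        using \<open>0 \<le> L\<close> by (intro mult_left_mono dist_bounded) auto
      finally show ?thesis by (simp add: ac_simps)
    qed
    then have "norm (integral {0..t} (\<lambda>s. ?f z s - ?f z' s)) \<le> L * ?D * exp (l * t) / l - L * ?D * exp (l * 0) / l"
      using integral_norm_bound_integral[OF integrable_diff[OF int int] has_integral_integrable[OF I]]
        integral_unique[OF I] by simp
    also have "\<dots> \<le> (L / l) * (?D * exp (l * t))" 
    proof -
      have "0 \<le> L * ?D / l" using \<open>0 \<le> L\<close> \<open>0 < l\<close> by simp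
      then show ?thesis by simp
    qed
    also have "\<dots> \<le> 1/2 * (?D * exp (l * t))"
      using \<open>L / l \<le> 1/2\<close> by (intro mult_right_mono) auto
    finally have b: "norm (integral {0..t} (?f z) - integral {0..t} (?f z')) \<le> 1/2 * ?D * exp (l * t)"
      using integral_diff[OF int int] by simp
    have "dist (P z t) (P z' t) = exp (- l * t) * norm (integral {0..t} (?f z) - integral {0..t} (?f z'))"
      by (simp add: P_def dist_norm scaleR_diff_right[symmetric])
    also have "\<dots> \<le> exp (- l * t) * (1/2 * ?D * exp (l * t))"
      using b by (intro mult_left_mono) auto
    also have "\<dots> = 1/2 * ?D" by (simp add: exp_minus field_simps)
    finally show ?thesis .
  qed
  have "\<exists>!z. Bcontfun (\<lambda>t. P z (clamp 0 T t)) = z"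
  proof (rule banach_fix_type)
    have "dist (Bcontfun (\<lambda>t. P z (clamp 0 T t))) (Bcontfun (\<lambda>t. P z' (clamp 0 T t))) \<le> 1/2 * dist z z'" for z z'
    proof (rule dist_bound)
      fix t
      have "clamp 0 T t \<in> {0..T}" using clamp_in_interval[of 0 T t] \<open>0 \<le> T\<close> by simp
      then show "dist (apply_bcontfun (Bcontfun (\<lambda>t. P z (clamp 0 T t))) t)
          (apply_bcontfun (Bcontfun (\<lambda>t. P z' (clamp 0 T t))) t) \<le> 1/2 * dist z z'"
        using contr by (simp add: Q)
    qed
    then show "\<forall>z z'. dist (Bcontfun (\<lambda>t. P z (clamp 0 T t))) (Bcontfun (\<lambda>t. P z' (clamp 0 T t))) \<le> 1/2 * dist z z'"
      by blast
  qed auto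
  then obtain z where z: "Bcontfun (\<lambda>t. P z (clamp 0 T t)) = z" by blast
  define x where "x t = exp (l * t) *\<^sub>R apply_bcontfun z t" for t
  have x: "x t = x\<^sub>0 + integral {0..t} (\<lambda>s. X (x s))" if "t \<in> {0..T}" for t
  proof -
    have "apply_bcontfun z t = P z t"
      using that Q[of z] z by (metis box_real(2) clamp_cancel_cbox)
    then show ?thesis by (simp add: x_def P_def exp_minus)
  qed
  have "(x has_vector_derivative X (x t)) (at t within {0..T})" if "t \<in> {0..T}" for t
  proof (rule has_vector_derivative_transform[OF that])
    show "((\<lambda>t. x\<^sub>0 + integral {0..t} (\<lambda>s. X (x s))) has_vector_derivative X (x t)) (at t within {0..T})"
      using integral_has_vector_derivative[OF cont_X that] by (auto intro!: derivative_eq_intros simp: x_def)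
  qed (use x in auto)
  moreover have "x 0 = x\<^sub>0" using x[of 0] \<open>0 \<le> T\<close> by simp
  ultimately show ?thesis by blast
qed

lemma lipschitz_of_bounded_vector_derivative:
  fixes f :: "real \<Rightarrow> 'a::real_normed_vector"
  assumes "\<And>t. t \<in> {a..b} \<Longrightarrow> (f has_vector_derivative f' t) (at t within {a..b})"
    and "\<And>t. t \<in> {a..b} \<Longrightarrow> norm (f' t) \<le> K" and "0 \<le> K"
  shows "K-lipschitz_on {a..b} f"
proof (rule bounded_derivative_imp_lipschitz)
  show "(f has_derivative (\<lambda>h. h *\<^sub>R f' t)) (at t within {a..b})" if "t \<in> {a..b}" for t
    using assms(1)[OF that] by (simp add: has_vector_derivative_def)
  show "onorm (\<lambda>h. h *\<^sub>R f' t) \<le> K" if "t \<in> {a..b}" for t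
    using assms(2)[OF that] \<open>0 \<le> K\<close>
    by (intro onorm_bound) (auto simp: mult.commute[of K] intro: mult_left_mono)
qed (use \<open>0 \<le> K\<close> in auto)

text \<open>During a short time \<open>T\<close> the constant velocity \<open>(p - x) / T\<close> dominates the Lipschitz field \<open>X\<close>: the solution
  follows the segment from \<open>x\<close> to \<open>p\<close> up to an error of order \<open>T\<close>. This is how a large constant
  control outruns the drift.\<close>
lemma ode_near_ballistic:
  fixes X :: "'a::euclidean_space \<Rightarrow> 'a"
  assumes lip: "L-lipschitz_on UNIV X" and "open U" and seg: "closed_segment x p \<subseteq> U" and "0 < \<epsilon>"
  obtains T y where "0 < T" "T \<le> \<epsilon>" "y 0 = x" "dist (y T) p \<le> \<epsilon>" "y ` {0..T} \<subseteq> U"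
    "\<And>t. t \<in> {0..T} \<Longrightarrow> (y has_vector_derivative X (y t) + (1 / T) *\<^sub>R (p - x)) (at t within {0..T})"
proof -
  have "0 \<le> L" using lip by (rule lipschitz_on_nonneg)
  have contX: "continuous_on S X" for S
    using lipschitz_on_continuous_on[OF lip] continuous_on_subset by blast
  obtain M\<^sub>0 where M\<^sub>0: "\<And>q. q \<in> closed_segment x p \<Longrightarrow> norm (X q) \<le> M\<^sub>0"
    using compact_imp_bounded[OF compact_continuous_image[OF contX compact_segment]]
    unfolding bounded_iff by blast
  define M where "M = \<bar>M\<^sub>0\<bar> + 1"
  have "0 < M" by (simp add: M_def)
  have M: "norm (X q) \<le> M" if "q \<in> closed_segment x p" for q
    using M\<^sub>0[OF that] by (simp add: M_def)
  obtain \<rho> where "0 < \<rho>" and \<rho>: "{q. infdist q (closed_segment x p) \<le> \<rho>} \<subseteq> U"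
    using compact_in_open_separated[of "closed_segment x p" U] seg \<open>open U\<close> by auto
  \<comment> \<open>With T L at most 1/2, the deviation D from uniform motion satisfies D \<le> T M + D/2; with
    2 T M at most \<rho> and \<epsilon>, the solution therefore stays in U and ends near p.\<close>
  define T where "T = min \<epsilon> (min (1 / (2 * (L + 1))) (min \<rho> \<epsilon> / (2 * M)))"
  have "0 < T" using \<open>0 < \<epsilon>\<close> \<open>0 < \<rho>\<close> \<open>0 < M\<close> \<open>0 \<le> L\<close> by (simp add: T_def)
  have "T * L \<le> 1/2"
  proof -
    have "T * L \<le> 1 / (2 * (L + 1)) * (L + 1)"
      using \<open>0 \<le> L\<close> \<open>0 < T\<close> by (intro mult_mono) (auto simp: T_def)
    also have "\<dots> = 1/2" using \<open>0 \<le> L\<close> by (simp add: field_simps)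
    finally show ?thesis .
  qed
  have "2 * T * M \<le> min \<rho> \<epsilon>"
  proof -
    have "T * M \<le> min \<rho> \<epsilon> / (2 * M) * M"
      using \<open>0 < M\<close> by (intro mult_right_mono) (auto simp: T_def)
    then show ?thesis using \<open>0 < M\<close> by simp
  qed
  define k where "k = (1 / T) *\<^sub>R (p - x)"
  have "L-lipschitz_on UNIV (\<lambda>y. X y + k)"
    using lip by (simp add: lipschitz_on_def)
  then obtain y where "y 0 = x"
    and y: "\<And>t. t \<in> {0..T} \<Longrightarrow> (y has_vector_derivative X (y t) + k) (at t within {0..T})"
    using autonomous_ode_solution_exists[of L "\<lambda>y. X y + k" T x] \<open>0 < T\<close> by auto
  have straight: "x + t *\<^sub>R k \<in> closed_segment x p" if "t \<in> {0..T}" for t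
    unfolding in_segment k_def using that \<open>0 < T\<close>
    by (intro exI[of _ "t / T"]) (auto simp: algebra_simps)
  define z where "z t = y t - (x + t *\<^sub>R k)" for t
  have z_deriv: "(z has_vector_derivative X (y t)) (at t within {0..T})" if "t \<in> {0..T}" for t
    unfolding z_def by (auto intro!: derivative_eq_intros y[OF that])
  then have cont_z: "continuous_on {0..T} z"
    by (meson continuous_on_eq_continuous_within has_vector_derivative_continuous)
  then obtain \<tau> where \<tau>: "\<tau> \<in> {0..T}" "\<And>t. t \<in> {0..T} \<Longrightarrow> norm (z t) \<le> norm (z \<tau>)"
    using continuous_attains_sup[OF compact_Icc _ continuous_on_norm[OF cont_z]] \<open>0 < T\<close> by fastforce
  define D where "D = norm (z \<tau>)"
  have "norm (X (y t)) \<le> M + L * D" if "t \<in> {0..T}" for t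
  proof -
    have "norm (X (y t)) \<le> norm (X (x + t *\<^sub>R k)) + norm (X (y t) - X (x + t *\<^sub>R k))"
      using norm_triangle_sub by blast
    also have "\<dots> \<le> M + L * norm (z t)"
      using M[OF straight[OF that]] lipschitz_on_normD[OF lip, of "y t" "x + t *\<^sub>R k"]
      by (intro add_mono) (auto simp: z_def)
    also have "\<dots> \<le> M + L * D" using \<tau>(2)[OF that] \<open>0 \<le> L\<close> by (simp add: D_def mult_left_mono)
    finally show ?thesis .
  qed
  then have "(M + L * D)-lipschitz_on {0..T} z"
    using \<open>0 \<le> L\<close> \<open>0 < M\<close> by (intro lipschitz_of_bounded_vector_derivative[OF z_deriv]) (auto simp: D_def)
  from lipschitz_on_normD[OF this \<tau>(1), of 0] have "D \<le> (M + L * D) * \<tau>"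
    using \<open>0 < T\<close> \<open>y 0 = x\<close> \<tau>(1) by (simp add: D_def z_def)
  also have "\<dots> \<le> (M + L * D) * T"
    using \<tau>(1) \<open>0 < M\<close> \<open>0 \<le> L\<close> by (intro mult_left_mono) (auto simp: D_def)
  also have "\<dots> = T * M + (T * L) * D" by (simp add: algebra_simps)
  also have "\<dots> \<le> T * M + 1/2 * D"
    using \<open>T * L \<le> 1/2\<close> by (intro add_left_mono mult_right_mono) (auto simp: D_def)
  finally have "D \<le> min \<rho> \<epsilon>" using \<open>2 * T * M \<le> min \<rho> \<epsilon>\<close> by simp
  then have near: "norm (y t - (x + t *\<^sub>R k)) \<le> min \<rho> \<epsilon>" if "t \<in> {0..T}" for t
    using \<tau>(2)[OF that] by (simp add: z_def D_def)
  show thesis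
  proof (rule that[of T y])
    show "T \<le> \<epsilon>" by (simp add: T_def)
    show "dist (y T) p \<le> \<epsilon>" using near[of T] \<open>0 < T\<close> by (simp add: k_def dist_norm)
    show "y ` {0..T} \<subseteq> U"
    proof clarify
      fix t assume t: "t \<in> {0..T}"
      have "infdist (y t) (closed_segment x p) \<le> dist (y t) (x + t *\<^sub>R k)"
        by (rule infdist_le[OF straight[OF t]])
      then show "y t \<in> U" using near[OF t] \<rho> by (auto simp: dist_norm)
    qed
  qed (use y \<open>0 < T\<close> \<open>y 0 = x\<close> in \<open>simp_all add: k_def\<close>)
qed

section \<open>Slices of the state set and the top rate\<close>

text \<open>The geometric core: the drift is \<open>F\<close>, the controls act orthogonally to the unit vector \<open>e\<close>, and the
  state has to be brought from height \<open>a\<close> to height \<open>b\<close> inside the convex set \<open>C\<close>, where the height of \<open>y\<close> is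
  \<open>y \<bullet> e\<close>.\<close>
locale slab_control =
  fixes F :: "'a::euclidean_space \<Rightarrow> 'a" and L :: real and e :: 'a and C :: "'a set"
    and x\<^sub>0 x\<^sub>1 :: 'a and a b :: real
  assumes lip: "L-lipschitz_on UNIV F" and unit: "norm e = 1"
    and bounded_C: "bounded C" and convex_C: "convex C"
    and x\<^sub>0: "x\<^sub>0 \<in> interior C" "x\<^sub>0 \<bullet> e = a" and x\<^sub>1: "x\<^sub>1 \<in> interior C" "x\<^sub>1 \<bullet> e = b"
    and a_less_b: "a < b"
begin

definition rate :: "'a \<Rightarrow> real" where
  "rate y = F y \<bullet> e"

definition top_rate :: "real \<Rightarrow> real" where
  "top_rate r = (SUP y \<in> {y \<in> C. y \<bullet> e = r}. rate y)"

lemma L_nonneg: "0 \<le> L"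
  using lip by (rule lipschitz_on_nonneg)

lemma continuous_F: "continuous_on S F"
  using lipschitz_on_continuous_on[OF lip] continuous_on_subset by blast

lemma rate_lipschitz: "\<bar>rate y - rate z\<bar> \<le> L * norm (y - z)"
proof -
  have "\<bar>(F y - F z) \<bullet> e\<bar> \<le> norm (F y - F z)"
    using Cauchy_Schwarz_ineq2[of "F y - F z" e] unit by simp
  also have "\<dots> \<le> L * norm (y - z)" using lipschitz_on_normD[OF lip] by simp
  finally show ?thesis by (simp add: rate_def inner_diff_left)
qed

lemma bdd_above_rate: "bdd_above (rate ` {y \<in> C. y \<bullet> e = r})"
proof -
  obtain M where M: "\<And>y. y \<in> C \<Longrightarrow> norm y \<le> M" using bounded_C bounded_iff by blast
  have "rate y \<le> rate 0 + L * M" if "y \<in> C" for y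
    using rate_lipschitz[of y 0] mult_left_mono[OF M[OF that] L_nonneg] by simp
  then show ?thesis by (intro bdd_aboveI[of _ "rate 0 + L * M"]) auto
qed

lemma rate_le_top_rate: "y \<in> C \<Longrightarrow> rate y \<le> top_rate (y \<bullet> e)"
  unfolding top_rate_def by (rule cSUP_upper[OF _ bdd_above_rate]) simp

text \<open>Points of \<open>C\<close> are pushed towards an interior point of \<open>C\<close> that lies strictly beyond the end
  of \<open>[a, b]\<close> ahead of them. Its height differs by at least some \<open>\<delta>\<close> from all the heights in
  \<open>[a, b]\<close>, which bounds the distance travelled per unit of height; and by convexity the pushed
  point is interior.\<close>
lemma slide_between_slices:
  obtains M where "0 \<le> M"
    and "\<And>p r. \<lbrakk>p \<in> C; p \<bullet> e \<in> {a..b}; r \<in> {a..b}\<rbrakk>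
      \<Longrightarrow> \<exists>p'\<in>C. p' \<bullet> e = r \<and> norm (p' - p) \<le> M * \<bar>r - p \<bullet> e\<bar> \<and> (r \<noteq> p \<bullet> e \<longrightarrow> p' \<in> interior C)"
proof -
  obtain \<delta>\<^sub>0 where \<delta>\<^sub>0: "0 < \<delta>\<^sub>0" "cball x\<^sub>0 \<delta>\<^sub>0 \<subseteq> interior C"
    using x\<^sub>0(1) open_contains_cball open_interior by blast
  obtain \<delta>\<^sub>1 where \<delta>\<^sub>1: "0 < \<delta>\<^sub>1" "cball x\<^sub>1 \<delta>\<^sub>1 \<subseteq> interior C"
    using x\<^sub>1(1) open_contains_cball open_interior by blast
  define \<delta> where "\<delta> = min \<delta>\<^sub>0 \<delta>\<^sub>1"
  have "0 < \<delta>" using \<delta>\<^sub>0 \<delta>\<^sub>1 by (simp add: \<delta>_def)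
  have ee: "e \<bullet> e = 1" using unit by (simp add: norm_eq_1)
  have low: "x\<^sub>0 - \<delta> *\<^sub>R e \<in> interior C" "(x\<^sub>0 - \<delta> *\<^sub>R e) \<bullet> e = a - \<delta>"
    and up: "x\<^sub>1 + \<delta> *\<^sub>R e \<in> interior C" "(x\<^sub>1 + \<delta> *\<^sub>R e) \<bullet> e = b + \<delta>"
  proof -
    show "x\<^sub>0 - \<delta> *\<^sub>R e \<in> interior C" "x\<^sub>1 + \<delta> *\<^sub>R e \<in> interior C"
      using \<open>0 < \<delta>\<close> unit by (auto simp: \<delta>_def dist_norm intro: subsetD[OF \<delta>\<^sub>0(2)] subsetD[OF \<delta>\<^sub>1(2)])
  qed (use x\<^sub>0 x\<^sub>1 ee in \<open>auto simp: inner_simps\<close>)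
  obtain D where D: "\<And>y. y \<in> C \<Longrightarrow> norm y \<le> D" using bounded_C bounded_iff by blast
  have "0 \<le> D" using D[of x\<^sub>0] x\<^sub>0(1) interior_subset norm_ge_zero order_trans by blast
  have slide: "\<exists>p'\<in>C. p' \<bullet> e = r \<and> norm (p' - p) \<le> 2 * D / \<delta> * \<bar>r - p \<bullet> e\<bar> \<and> p' \<in> interior C"
    if "p \<in> C" "q \<in> interior C" "\<delta> \<le> \<bar>q \<bullet> e - p \<bullet> e\<bar>" "0 < (r - p \<bullet> e) / (q \<bullet> e - p \<bullet> e)"
      "(r - p \<bullet> e) / (q \<bullet> e - p \<bullet> e) \<le> 1" for p q r
  proof -
    define s where "s = (r - p \<bullet> e) / (q \<bullet> e - p \<bullet> e)"
    define p' where "p' = p - s *\<^sub>R (p - q)"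
    have "q \<bullet> e - p \<bullet> e \<noteq> 0" using that(3) \<open>0 < \<delta>\<close> by auto
    then have "p' \<bullet> e = r"
      by (simp add: p'_def s_def inner_simps) (simp add: field_simps)
    have "p' \<in> interior C" unfolding p'_def
      by (rule mem_interior_convex_shrink[OF convex_C]) (use that in \<open>auto simp: s_def\<close>)
    have "s = \<bar>r - p \<bullet> e\<bar> / \<bar>q \<bullet> e - p \<bullet> e\<bar>"
      using that(4) by (simp add: s_def flip: abs_divide)
    also have "\<dots> \<le> \<bar>r - p \<bullet> e\<bar> / \<delta>"
      using that(3) \<open>0 < \<delta>\<close> by (intro divide_left_mono mult_pos_pos) auto
    finally have "s * norm (p - q) \<le> \<bar>r - p \<bullet> e\<bar> / \<delta> * (2 * D)"
      using D[of p] D[of q] that interior_subset[of C] norm_triangle_ineq4[of p q] \<open>0 < \<delta>\<close>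
      by (intro mult_mono) auto
    moreover have "norm (p' - p) = s * norm (p - q)"
    proof -
      have "0 < s" using that(4) by (simp add: s_def)
      then show ?thesis by (simp add: p'_def)
    qed
    ultimately have "norm (p' - p) \<le> 2 * D / \<delta> * \<bar>r - p \<bullet> e\<bar>"
      by (simp add: mult.commute)
    then show ?thesis using \<open>p' \<bullet> e = r\<close> \<open>p' \<in> interior C\<close> interior_subset by blast
  qed
  show thesis
  proof (rule that[of "2 * D / \<delta>"])
    show "0 \<le> 2 * D / \<delta>" using \<open>0 \<le> D\<close> \<open>0 < \<delta>\<close> by simp
    fix p r assume p: "p \<in> C" "p \<bullet> e \<in> {a..b}" "r \<in> {a..b}"
    consider "r = p \<bullet> e" | "r < p \<bullet> e" | "p \<bullet> e < r" by linarith
    then show "\<exists>p'\<in>C. p' \<bullet> e = r \<and> norm (p' - p) \<le> 2 * D / \<delta> * \<bar>r - p \<bullet> e\<bar>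
        \<and> (r \<noteq> p \<bullet> e \<longrightarrow> p' \<in> interior C)"
    proof cases
      case 1
      then show ?thesis using p by (intro bexI[of _ p]) auto
    next
      case 2
      then show ?thesis
        using slide[OF p(1) low(1), of r] p \<open>0 < \<delta>\<close> unfolding low(2) by (fastforce simp: divide_simps)
    next
      case 3
      then show ?thesis
        using slide[OF p(1) up(1), of r] p \<open>0 < \<delta>\<close> unfolding up(2) by (fastforce simp: divide_simps)
    qed
  qed
qed

lemma interior_slice_nonempty:
  assumes "r \<in> {a..b}"
  obtains m where "m \<in> interior C" "m \<bullet> e = r"
proof -
  let ?u = "(r - a) / (b - a)"
  have "x\<^sub>0 + ?u *\<^sub>R (x\<^sub>1 - x\<^sub>0) \<in> closed_segment x\<^sub>0 x\<^sub>1"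
    unfolding in_segment
    using assms a_less_b by (intro exI[of _ ?u]) (auto simp: algebra_simps)
  also have "\<dots> \<subseteq> interior C"
    using x\<^sub>0 x\<^sub>1 convex_interior[OF convex_C] by (intro closed_segment_subset)
  finally show ?thesis
    using that a_less_b x\<^sub>0 x\<^sub>1 by (auto simp: inner_simps)
qed

text \<open>The set \<open>C\<close> may lack its boundary points, so the supremum need not be attained. A nearly optimal
  point of the slice becomes interior when it is moved slightly towards an interior point of the
  same slice, at the cost of an arbitrarily small loss in the rate.\<close>
lemma top_rate_approx:
  assumes "r \<in> {a..b}" "0 < \<eta>"
  obtains p where "p \<in> interior C" "p \<bullet> e = r" "top_rate r - \<eta> < rate p"
proof -
  obtain m where m: "m \<in> interior C" "m \<bullet> e = r" using interior_slice_nonempty[OF assms(1)] .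
  have ne: "{y \<in> C. y \<bullet> e = r} \<noteq> {}" using m interior_subset by blast
  have "top_rate r - \<eta>/2 < top_rate r" using assms by simp
  then obtain p where p: "p \<in> C" "p \<bullet> e = r" "top_rate r - \<eta>/2 < rate p"
    using less_cSUP_iff[OF ne bdd_above_rate] unfolding top_rate_def by auto
  define s where "s = min 1 (\<eta> / (2 * (L * norm (p - m) + 1)))"
  have pos: "0 < L * norm (p - m) + 1" using L_nonneg by (simp add: add_nonneg_pos)
  then have "0 < s" "s \<le> 1" using assms(2) by (auto simp: s_def)
  define q where "q = p - s *\<^sub>R (p - m)"
  have "q \<in> interior C" unfolding q_def
    using mem_interior_convex_shrink[OF convex_C m(1) p(1)] \<open>0 < s\<close> \<open>s \<le> 1\<close> .
  moreover have "q \<bullet> e = r" using m p by (simp add: q_def inner_simps)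
  moreover have "rate p - rate q \<le> \<eta>/2"
  proof -
    have "rate p - rate q \<le> s * (L * norm (p - m))"
      using rate_lipschitz[of p q] \<open>0 < s\<close> by (simp add: q_def mult.left_commute)
    also have "\<dots> \<le> s * (L * norm (p - m) + 1)" using \<open>0 < s\<close> by simp
    also have "\<dots> \<le> \<eta> / (2 * (L * norm (p - m) + 1)) * (L * norm (p - m) + 1)"
      using pos by (intro mult_right_mono) (auto simp: s_def)
    also have "\<dots> = \<eta>/2" using pos by (simp add: field_simps)
    finally show ?thesis .
  qed
  ultimately show ?thesis using that p by fastforce
qed

text \<open>Sliding a point to another slice changes its rate by at most a multiple of the difference in
  height.\<close>
lemma top_rate_lipschitz: obtains K where "K-lipschitz_on {a..b} top_rate"
proof -
  obtain M where "0 \<le> M"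
    and M: "\<And>p r. \<lbrakk>p \<in> C; p \<bullet> e \<in> {a..b}; r \<in> {a..b}\<rbrakk>
      \<Longrightarrow> \<exists>p'\<in>C. p' \<bullet> e = r \<and> norm (p' - p) \<le> M * \<bar>r - p \<bullet> e\<bar> \<and> (r \<noteq> p \<bullet> e \<longrightarrow> p' \<in> interior C)"
    using slide_between_slices by blast
  have le: "top_rate r \<le> top_rate r' + L * M * \<bar>r - r'\<bar>" if r: "r \<in> {a..b}" "r' \<in> {a..b}" for r r'
    unfolding top_rate_def[of r]
  proof (rule cSUP_least)
    obtain m where "m \<in> interior C" "m \<bullet> e = r" using interior_slice_nonempty[OF r(1)] .
    then show "{y \<in> C. y \<bullet> e = r} \<noteq> {}" using interior_subset by blast
    fix p assume "p \<in> {y \<in> C. y \<bullet> e = r}"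
    then have p: "p \<in> C" "p \<bullet> e = r" by auto
    obtain p' where p': "p' \<in> C" "p' \<bullet> e = r'" "norm (p' - p) \<le> M * \<bar>r' - r\<bar>"
      using M[of p r'] p r by auto
    have "rate p \<le> rate p' + L * norm (p' - p)"
      using rate_lipschitz[of p p'] by (simp add: norm_minus_commute)
    also have "\<dots> \<le> top_rate r' + L * (M * \<bar>r' - r\<bar>)"
      using rate_le_top_rate[OF p'(1)] p' L_nonneg by (intro add_mono mult_left_mono) auto
    finally show "rate p \<le> top_rate r' + L * M * \<bar>r - r'\<bar>" by (simp add: abs_minus_commute)
  qed
  have "(L * M)-lipschitz_on {a..b} top_rate"
  proof (rule lipschitz_onI)
    fix r r' assume r: "r \<in> {a..b}" "r' \<in> {a..b}"
    then show "dist (top_rate r) (top_rate r') \<le> L * M * dist r r'"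
      using le[OF r] le[OF r(2,1)] by (simp add: dist_real_def abs_minus_commute)
  qed (use L_nonneg \<open>0 \<le> M\<close> in simp)
  then show ?thesis using that by blast
qed

end

section \<open>Steering with bounded controls\<close>

context slab_control
begin

text \<open>The velocity produced by the control is \<open>v\<close>, which has to be orthogonal to \<open>e\<close>. The finite exceptional
  set \<open>S\<close> makes the relation closed under concatenation, where the velocity may jump.\<close>
definition steers :: "real \<Rightarrow> 'a \<Rightarrow> 'a \<Rightarrow> bool" where
  "steers T x z \<longleftrightarrow> 0 \<le> T \<and> (\<exists>y v S. (\<exists>K. K-lipschitz_on {0..T} y)
     \<and> v \<in> borel_measurable borel \<and> bounded (range v) \<and> (\<forall>t. v t \<bullet> e = 0) \<and> finite S
     \<and> (\<forall>t\<in>{0..T} - S. (y has_vector_derivative F (y t) + v t) (at t within {0..T}))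
     \<and> y ` {0..T} \<subseteq> C \<and> y 0 = x \<and> y T = z)"

lemma steers_refl: "x \<in> C \<Longrightarrow> steers 0 x x"
  unfolding steers_def
  by (intro conjI exI[of _ "\<lambda>_. x"] exI[of _ "\<lambda>_. 0"] exI[of _ "{0}"] exI[of _ 0]) auto

lemma steers_trans:
  assumes "steers T x y" "steers U y z"
  shows "steers (T + U) x z"
proof -
  obtain y\<^sub>1 v\<^sub>1 S\<^sub>1 K\<^sub>1 where 1: "0 \<le> T" "K\<^sub>1-lipschitz_on {0..T} y\<^sub>1" "v\<^sub>1 \<in> borel_measurable borel"
      "bounded (range v\<^sub>1)" "\<And>t. v\<^sub>1 t \<bullet> e = 0" "finite S\<^sub>1"
      "\<And>t. t \<in> {0..T} - S\<^sub>1 \<Longrightarrow> (y\<^sub>1 has_vector_derivative F (y\<^sub>1 t) + v\<^sub>1 t) (at t within {0..T})"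
      "y\<^sub>1 ` {0..T} \<subseteq> C" "y\<^sub>1 0 = x" "y\<^sub>1 T = y"
    using assms(1) unfolding steers_def by metis
  obtain y\<^sub>2 v\<^sub>2 S\<^sub>2 K\<^sub>2 where 2: "0 \<le> U" "K\<^sub>2-lipschitz_on {0..U} y\<^sub>2" "v\<^sub>2 \<in> borel_measurable borel"
      "bounded (range v\<^sub>2)" "\<And>t. v\<^sub>2 t \<bullet> e = 0" "finite S\<^sub>2"
      "\<And>t. t \<in> {0..U} - S\<^sub>2 \<Longrightarrow> (y\<^sub>2 has_vector_derivative F (y\<^sub>2 t) + v\<^sub>2 t) (at t within {0..U})"
      "y\<^sub>2 ` {0..U} \<subseteq> C" "y\<^sub>2 0 = y" "y\<^sub>2 U = z"
    using assms(2) unfolding steers_def by metis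
  define w where "w t = (if t \<le> T then y\<^sub>1 t else y\<^sub>2 (t - T))" for t
  define v where "v t = (if t \<le> T then v\<^sub>1 t else v\<^sub>2 (t - T))" for t
  \<comment> \<open>The concatenated trajectory may have a kink at the junction T.\<close>
  define S where "S = S\<^sub>1 \<union> (+) T ` S\<^sub>2 \<union> {T}"
  have shift: "(\<lambda>t. t - T) ` {T..T + U} = {0..U}"
    by (simp add: image_minus_const_atLeastAtMost')
  have "K\<^sub>2-lipschitz_on {T..T + U} (\<lambda>t. y\<^sub>2 (t - T))"
  proof (rule lipschitz_onI)
    fix s t assume "s \<in> {T..T + U}" "t \<in> {T..T + U}"
    then show "dist (y\<^sub>2 (s - T)) (y\<^sub>2 (t - T)) \<le> K\<^sub>2 * dist s t"
      using lipschitz_onD[OF 2(2), of "s - T" "t - T"] by (simp add: dist_real_def)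
  qed (rule lipschitz_on_nonneg[OF 2(2)])
  then have "(max K\<^sub>1 K\<^sub>2)-lipschitz_on {0..T + U} w"
    unfolding w_def using 1 2 by (intro lipschitz_on_concat_max) auto
  moreover have "v \<in> borel_measurable borel"
    unfolding v_def using 1(3) 2(3) by measurable
  moreover have "bounded (range v)"
    by (rule bounded_subset[of "range v\<^sub>1 \<union> range v\<^sub>2"]) (use 1 2 in \<open>auto simp: v_def\<close>)
  moreover have "v t \<bullet> e = 0" for t using 1 2 by (simp add: v_def)
  moreover have "finite S" using 1 2 by (simp add: S_def)
  moreover have "(w has_vector_derivative F (w t) + v t) (at t within {0..T + U})"
    if t: "t \<in> {0..T + U} - S" for t
  proof (cases "t < T")
    case True
    then have "(y\<^sub>1 has_vector_derivative F (w t) + v t) (at t within {0..T})"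
      using 1(7)[of t] t by (auto simp: w_def v_def S_def)
    moreover have "at t within {0..T + U} = at t within {0..T}"
      using True t 2(1) by (intro at_within_nhd[of t "{..<T}"]) auto
    ultimately have "(y\<^sub>1 has_vector_derivative F (w t) + v t) (at t within {0..T + U})" by simp
    then show ?thesis
      by (rule has_vector_derivative_transform_within[where d = "T - t"])
        (use True t in \<open>auto simp: w_def dist_real_def\<close>)
  next
    case False
    then have "T < t" using t by (auto simp: S_def)
    have "t - T \<notin> S\<^sub>2"
    proof
      assume "t - T \<in> S\<^sub>2"
      then have "T + (t - T) \<in> (+) T ` S\<^sub>2" by (rule imageI)
      then show False using t by (simp add: S_def)
    qed
    then have "(y\<^sub>2 has_vector_derivative F (w t) + v t) (at (t - T) within (\<lambda>t. t - T) ` {T..T + U})"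
      using 2(7)[of "t - T"] t \<open>T < t\<close> unfolding shift by (auto simp: w_def v_def)
    then have "((y\<^sub>2 \<circ> (\<lambda>t. t - T)) has_vector_derivative 1 *\<^sub>R (F (w t) + v t)) (at t within {T..T + U})"
      by (intro vector_diff_chain_within) (auto intro!: derivative_eq_intros)
    moreover have "at t within {0..T + U} = at t within {T..T + U}"
      using \<open>T < t\<close> t 1(1) by (intro at_within_nhd[of t "{T<..}"]) auto
    ultimately have "((y\<^sub>2 \<circ> (\<lambda>t. t - T)) has_vector_derivative F (w t) + v t) (at t within {0..T + U})"
      by simp
    then show ?thesis
      by (rule has_vector_derivative_transform_within[where d = "t - T"])
        (use \<open>T < t\<close> t in \<open>auto simp: w_def dist_real_def\<close>)
  qed
  moreover have "w ` {0..T + U} \<subseteq> C"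
    using 1(8) 2(8) by (force simp: w_def)
  moreover have "w 0 = x" "w (T + U) = z" using 1 2 by (auto simp: w_def)
  ultimately show ?thesis unfolding steers_def using 1(1) 2(1) by (metis add_nonneg_nonneg)
qed

text \<open>A continuous velocity on \<open>[0, T]\<close> is extended by its values at the end points to obtain a bounded Borel
  function on the whole line.\<close>
lemma steersI_continuous:
  assumes "0 \<le> T" and cont_v: "continuous_on {0..T} v" and "\<And>t. t \<in> {0..T} \<Longrightarrow> v t \<bullet> e = 0"
    and y: "\<And>t. t \<in> {0..T} \<Longrightarrow> (y has_vector_derivative F (y t) + v t) (at t within {0..T})"
    and "y ` {0..T} \<subseteq> C"
  shows "steers T (y 0) (y T)"
proof -
  have cont_y: "continuous_on {0..T} y"
    using y by (meson continuous_on_eq_continuous_within has_vector_derivative_continuous)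
  have cont: "continuous_on {0..T} (\<lambda>t. F (y t) + v t)"
    by (intro continuous_intros cont_v continuous_on_compose2[OF continuous_F cont_y]) auto
  then obtain K where K: "\<And>t. t \<in> {0..T} \<Longrightarrow> norm (F (y t) + v t) \<le> K"
    using compact_imp_bounded[OF compact_continuous_image[OF cont compact_Icc]] unfolding bounded_iff by blast
  have "\<bar>K\<bar>-lipschitz_on {0..T} y"
    by (rule lipschitz_of_bounded_vector_derivative[OF y]) (use K in force)+
  moreover have clamp: "clamp 0 T t \<in> {0..T}" for t
    using clamp_in_interval[of 0 T t] \<open>0 \<le> T\<close> by simp
  have "(\<lambda>t. v (clamp 0 T t)) \<in> borel_measurable borel"
    using clamp_continuous_on[of 0 T v UNIV] cont_v by (intro borel_measurable_continuous_onI) simp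
  moreover have "bounded (range (\<lambda>t. v (clamp 0 T t)))"
    using clamp_bounded[of v 0 T] compact_imp_bounded[OF compact_continuous_image[OF cont_v]] by simp
  moreover have "v (clamp 0 T t) \<bullet> e = 0" for t using clamp assms(3) by blast
  moreover have "(y has_vector_derivative F (y t) + v (clamp 0 T t)) (at t within {0..T})"
    if "t \<in> {0..T} - {}" for t
    using that y[of t] by simp
  ultimately show ?thesis unfolding steers_def
    using \<open>0 \<le> T\<close> \<open>y ` {0..T} \<subseteq> C\<close> by (metis finite.emptyI)
qed

text \<open>The start and the target have the same height, so the velocity that carries one to the other in time
  \<open>T\<close> is orthogonal to \<open>e\<close>, hence available as a control. The drift prevents hitting the target
  exactly.\<close>
lemma steers_fast_within_slice:
  assumes "x \<in> interior C" "p \<in> interior C" "x \<bullet> e = p \<bullet> e" "0 < \<epsilon>"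
  obtains T q where "T \<le> \<epsilon>" "dist q p \<le> \<epsilon>" "steers T x q"
proof -
  have seg: "closed_segment x p \<subseteq> interior C"
    using assms convex_interior[OF convex_C] by (intro closed_segment_subset)
  obtain T y where y: "0 < T" "T \<le> \<epsilon>" "y 0 = x" "dist (y T) p \<le> \<epsilon>" "y ` {0..T} \<subseteq> interior C"
    "\<And>t. t \<in> {0..T} \<Longrightarrow> (y has_vector_derivative F (y t) + (1 / T) *\<^sub>R (p - x)) (at t within {0..T})"
    using ode_near_ballistic[OF lip open_interior seg \<open>0 < \<epsilon>\<close>] by blast
  have "steers T (y 0) (y T)"
  proof (rule steersI_continuous)
    show "(1 / T) *\<^sub>R (p - x) \<bullet> e = 0" using assms(3) by (simp add: inner_diff_left)
    show "y ` {0..T} \<subseteq> C" using y(5) interior_subset by blast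
  qed (use y in auto)
  then show thesis using that y by simp
qed

text \<open>The reversed manoeuvre reaches \<open>x\<close> exactly, from some point near \<open>p\<close>. It runs the fast motion for the
  drift \<open>- F\<close> backwards in time.\<close>
lemma steers_fast_within_slice_rev:
  assumes "x \<in> interior C" "p \<in> interior C" "x \<bullet> e = p \<bullet> e" "0 < \<epsilon>"
  obtains T q where "T \<le> \<epsilon>" "dist q p \<le> \<epsilon>" "steers T q x"
proof -
  have seg: "closed_segment x p \<subseteq> interior C"
    using assms convex_interior[OF convex_C] by (intro closed_segment_subset)
  have lip': "L-lipschitz_on UNIV (\<lambda>y. - F y)" using lip by simp
  obtain T y where y: "0 < T" "T \<le> \<epsilon>" "y 0 = x" "dist (y T) p \<le> \<epsilon>" "y ` {0..T} \<subseteq> interior C"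
    "\<And>t. t \<in> {0..T} \<Longrightarrow> (y has_vector_derivative - F (y t) + (1 / T) *\<^sub>R (p - x)) (at t within {0..T})"
    using ode_near_ballistic[OF lip' open_interior seg \<open>0 < \<epsilon>\<close>] by blast
  have flip: "(\<lambda>t. T - t) ` {0..T} = {0..T}" by simp
  have "steers T ((y \<circ> (\<lambda>t. T - t)) 0) ((y \<circ> (\<lambda>t. T - t)) T)"
  proof (rule steersI_continuous)
    show "(1 / T) *\<^sub>R (x - p) \<bullet> e = 0" using assms(3) by (simp add: inner_diff_left)
    show "(y \<circ> (\<lambda>t. T - t)) ` {0..T} \<subseteq> C"
      using y(5) interior_subset[of C] unfolding image_comp[symmetric] flip by blast
    fix t assume "t \<in> {0..T}"
    then have "(y has_vector_derivative - F (y (T - t)) + (1 / T) *\<^sub>R (p - x)) (at (T - t) within (\<lambda>t. T - t) ` {0..T})"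
      using y(6)[of "T - t"] unfolding flip by simp
    then have "((y \<circ> (\<lambda>t. T - t)) has_vector_derivative (- 1) *\<^sub>R (- F (y (T - t)) + (1 / T) *\<^sub>R (p - x))) (at t within {0..T})"
      by (intro vector_diff_chain_within) (auto intro!: derivative_eq_intros)
    then show "((y \<circ> (\<lambda>t. T - t)) has_vector_derivative F ((y \<circ> (\<lambda>t. T - t)) t) + (1 / T) *\<^sub>R (x - p)) (at t within {0..T})"
      by (simp add: algebra_simps)
  qed (use y in auto)
  then show thesis using that y by simp
qed

text \<open>On a segment that ascends in height and along which the rate is positive, the state may follow the segment:
  its speed is forced by the condition that the height grows at the current rate, which is a
  scalar differential equation for the height, and the rest of the velocity is orthogonal to \<open>e\<close>.\<close>
lemma steers_along_segment:
  assumes "p \<in> C" "q \<in> C" "p \<bullet> e < q \<bullet> e" "0 < c"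
    and c: "\<And>y. y \<in> closed_segment p q \<Longrightarrow> c \<le> rate y"
  obtains T where "T \<le> (q \<bullet> e - p \<bullet> e) / c" "steers T p q"
proof -
  define l where "l = q \<bullet> e - p \<bullet> e"
  define d where "d = (1 / l) *\<^sub>R (q - p)"
  have "0 < l" using assms by (simp add: l_def)
  have "d \<bullet> e = 1" using \<open>0 < l\<close> by (simp add: d_def l_def inner_diff_left)
  have seg: "p + s *\<^sub>R d \<in> closed_segment p q" if "s \<in> {0..l}" for s
    unfolding in_segment d_def using that \<open>0 < l\<close>
    by (intro exI[of _ "s / l"]) (auto simp: algebra_simps)
  have clamp: "clamp 0 l s \<in> {0..l}" for s
    using clamp_in_interval[of 0 l s] \<open>0 < l\<close> by simp
  \<comment> \<open>Clamping makes the right-hand side globally Lipschitz and bounded below by c.\<close>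
  define G where "G s = rate (p + clamp 0 l s *\<^sub>R d)" for s
  have G: "c \<le> G s" for s using c[OF seg[OF clamp]] by (simp add: G_def)
  have "(L * norm d)-lipschitz_on UNIV G"
  proof (rule lipschitz_onI)
    fix s s'
    have "dist (G s) (G s') \<le> L * (norm d * dist (clamp 0 l s) (clamp 0 l s'))"
      using rate_lipschitz[of "p + clamp 0 l s *\<^sub>R d" "p + clamp 0 l s' *\<^sub>R d"]
      by (simp add: G_def dist_real_def mult.commute flip: scaleR_diff_left)
    also have "\<dots> \<le> L * (norm d * dist s s')"
      using L_nonneg dist_clamps_le_dist_args by (intro mult_left_mono) auto
    finally show "dist (G s) (G s') \<le> L * norm d * dist s s'" by (simp add: mult.assoc)
  qed (use L_nonneg in simp)
  note lip_G = this
  then obtain w where "w 0 = 0"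
    and w: "\<And>t. t \<in> {0..l / c} \<Longrightarrow> (w has_vector_derivative G (w t)) (at t within {0..l / c})"
    using autonomous_ode_solution_exists[of "L * norm d" G "l / c" 0] \<open>0 < l\<close> \<open>0 < c\<close> by auto
  have grow: "c * (t - s) \<le> w t - w s" if "0 \<le> s" "s \<le> t" "t \<le> l / c" for s t
  proof (cases "s = t")
    case False
    then have "s < t" using that by simp
    have "(w has_derivative (\<lambda>h. h * G (w r))) (at r within {s..t})" if "s \<le> r" "r \<le> t" for r
      using w[of r] that \<open>0 \<le> s\<close> \<open>t \<le> l / c\<close> unfolding has_vector_derivative_def
      by (auto intro: has_derivative_subset)
    from mvt_simple[OF \<open>s < t\<close> this] obtain r where "w t - w s = (t - s) * G (w r)" by blast
    then show ?thesis using mult_right_mono[OF G[of "w r"], of "t - s"] \<open>s < t\<close> by (simp add: mult.commute)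
  qed simp
  have cont_w: "continuous_on {0..l / c} w"
    using w by (meson continuous_on_eq_continuous_within has_vector_derivative_continuous)
  have "l \<le> w (l / c)" using grow[of 0 "l / c"] \<open>w 0 = 0\<close> \<open>0 < l\<close> \<open>0 < c\<close> by simp
  then obtain T where T: "0 \<le> T" "T \<le> l / c" "w T = l"
    using IVT'[of w 0 l "l / c"] cont_w \<open>w 0 = 0\<close> \<open>0 < l\<close> \<open>0 < c\<close> by auto
  have w_range: "w t \<in> {0..l}" if "t \<in> {0..T}" for t
  proof -
    have "0 \<le> c * t" "0 \<le> c * (T - t)" using that \<open>0 < c\<close> by auto
    then show ?thesis using grow[of 0 t] grow[of t T] T that \<open>w 0 = 0\<close> by auto
  qed
  define y where "y t = p + w t *\<^sub>R d" for t
  have Gy: "G (w t) = rate (y t)" if "t \<in> {0..T}" for t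
    using w_range[OF that] by (simp add: G_def y_def)
  have cont: "continuous_on {0..T} w" using cont_w T by (auto intro: continuous_on_subset)
  have "steers T (y 0) (y T)"
  proof (rule steersI_continuous)
    show "continuous_on {0..T} (\<lambda>t. G (w t) *\<^sub>R d - F (y t))"
      unfolding y_def
      by (intro continuous_intros cont continuous_on_compose2[OF lipschitz_on_continuous_on[OF lip_G]]
          continuous_on_compose2[OF continuous_F[of UNIV]]) auto
    show "(G (w t) *\<^sub>R d - F (y t)) \<bullet> e = 0" if "t \<in> {0..T}" for t
      using Gy[OF that] \<open>d \<bullet> e = 1\<close> by (simp add: inner_diff_left rate_def)
    show "(y has_vector_derivative F (y t) + (G (w t) *\<^sub>R d - F (y t))) (at t within {0..T})"
      if "t \<in> {0..T}" for t
    proof -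
      have "(w has_vector_derivative G (w t)) (at t within {0..T})"
        using w[of t] that T by (auto intro: has_vector_derivative_within_subset)
      then show ?thesis
        unfolding y_def by (auto intro!: derivative_eq_intros simp: has_real_derivative_iff_has_vector_derivative)
    qed
    have "closed_segment p q \<subseteq> C" using assms convex_C by (intro closed_segment_subset)
    then show "y ` {0..T} \<subseteq> C" using seg w_range by (auto simp: y_def)
  qed (use T in auto)
  moreover have "y 0 = p" "y T = q" using \<open>w 0 = 0\<close> \<open>w T = l\<close> \<open>0 < l\<close> by (auto simp: y_def d_def)
  ultimately show thesis using that[of T] T by (simp add: l_def)
qed

lemma steers_endpoints: "steers T x z \<Longrightarrow> x \<in> C \<and> z \<in> C"
  unfolding steers_def by force

text \<open>The basic manoeuvre: jump inside the slice of \<open>x\<close> to a point near \<open>p\<close>, follow a segment close to the one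
  from \<open>p\<close> to \<open>p'\<close>, and jump inside the slice of \<open>p'\<close> into \<open>z\<close>. As the forward jump is inexact at its end and
  the reversed jump at its start, the segment has to join two approximate points; this is harmless
  for \<open>\<epsilon> \<rightarrow> 0\<close>, and both ends \<open>x\<close> and \<open>z\<close> are met exactly.\<close>
lemma steers_near_segment:
  assumes int: "x \<in> interior C" "p \<in> interior C" "p' \<in> interior C" "z \<in> interior C"
    and "x \<bullet> e = p \<bullet> e" "z \<bullet> e = p' \<bullet> e" "p \<bullet> e < p' \<bullet> e" and "0 < c"
    and c: "\<And>y. y \<in> closed_segment p p' \<Longrightarrow> c \<le> rate y"
    and U: "(p' \<bullet> e - p \<bullet> e) / c < U"
  obtains T where "T \<le> U" "steers T x z"
proof -
  define \<Delta> where "\<Delta> = p' \<bullet> e - p \<bullet> e"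
  have "0 < \<Delta>" using assms by (simp add: \<Delta>_def)
  have "((\<lambda>\<epsilon>. 2 * \<epsilon> + (\<Delta> + 2 * \<epsilon>) / (c - L * \<epsilon>)) \<longlongrightarrow> 2 * 0 + (\<Delta> + 2 * 0) / (c - L * 0)) (at_right 0)"
    using \<open>0 < c\<close> by (intro tendsto_intros) auto
  then have "\<forall>\<^sub>F \<epsilon> in at_right 0. 2 * \<epsilon> + (\<Delta> + 2 * \<epsilon>) / (c - L * \<epsilon>) < U"
    using U by (intro order_tendstoD) (auto simp: \<Delta>_def)
  moreover have "((\<lambda>\<epsilon>. L * \<epsilon>) \<longlongrightarrow> L * 0) (at_right 0)" "((\<lambda>\<epsilon>::real. 2 * \<epsilon>) \<longlongrightarrow> 2 * 0) (at_right 0)"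
    by (intro tendsto_intros)+
  then have "\<forall>\<^sub>F \<epsilon> in at_right 0. L * \<epsilon> < c" "\<forall>\<^sub>F \<epsilon>::real in at_right 0. 2 * \<epsilon> < \<Delta>"
    using \<open>0 < c\<close> \<open>0 < \<Delta>\<close> by (auto intro: order_tendstoD)
  moreover have "\<forall>\<^sub>F \<epsilon>::real in at_right 0. 0 < \<epsilon>" by (rule eventually_at_right_less)
  ultimately have "\<forall>\<^sub>F \<epsilon> in at_right 0. 2 * \<epsilon> + (\<Delta> + 2 * \<epsilon>) / (c - L * \<epsilon>) < U \<and> L * \<epsilon> < c \<and> 2 * \<epsilon> < \<Delta> \<and> 0 < \<epsilon>"
    by eventually_elim auto
  then obtain \<epsilon> where \<epsilon>: "2 * \<epsilon> + (\<Delta> + 2 * \<epsilon>) / (c - L * \<epsilon>) < U" "L * \<epsilon> < c" "2 * \<epsilon> < \<Delta>" "0 < \<epsilon>"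
    using eventually_happens'[OF trivial_limit_at_right_real] by blast
  obtain T\<^sub>1 q where 1: "T\<^sub>1 \<le> \<epsilon>" "dist q p \<le> \<epsilon>" "steers T\<^sub>1 x q"
    using steers_fast_within_slice[OF int(1,2) assms(5) \<epsilon>(4)] by blast
  obtain T\<^sub>3 q' where 3: "T\<^sub>3 \<le> \<epsilon>" "dist q' p' \<le> \<epsilon>" "steers T\<^sub>3 q' z"
    using steers_fast_within_slice_rev[OF int(4,3) assms(6) \<epsilon>(4)] by blast
  have height: "\<bar>u \<bullet> e - v \<bullet> e\<bar> \<le> dist u v" for u v
    using Cauchy_Schwarz_ineq2[of "u - v" e] unit by (simp add: dist_norm inner_diff_left)
  have q_height: "q' \<bullet> e - q \<bullet> e \<le> \<Delta> + 2 * \<epsilon>" "q \<bullet> e < q' \<bullet> e"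
    using height[of q p] height[of q' p'] 1(2) 3(2) \<epsilon>(3) unfolding \<Delta>_def by linarith+
  have rate_q: "c - L * \<epsilon> \<le> rate y" if y: "y \<in> closed_segment q q'" for y
  proof -
    obtain s where s: "0 \<le> s" "s \<le> 1" "y = (1 - s) *\<^sub>R q + s *\<^sub>R q'" using y unfolding in_segment by blast
    define y' where "y' = (1 - s) *\<^sub>R p + s *\<^sub>R p'"
    have "y' \<in> closed_segment p p'" unfolding in_segment y'_def using s by blast
    have "norm (y' - y) \<le> (1 - s) * norm (q - p) + s * norm (q' - p')"
    proof -
      have "y - y' = (1 - s) *\<^sub>R (q - p) + s *\<^sub>R (q' - p')" by (simp add: s y'_def algebra_simps)
      then have "norm (y - y') \<le> norm ((1 - s) *\<^sub>R (q - p)) + norm (s *\<^sub>R (q' - p'))"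
        using norm_triangle_ineq by metis
      then show ?thesis using s by (simp add: norm_minus_commute)
    qed
    also have "\<dots> \<le> \<epsilon>"
      using convex_bound_le[of "norm (q - p)" \<epsilon> "norm (q' - p')" "1 - s" s] 1 3 s by (simp add: dist_norm)
    finally have "L * norm (y' - y) \<le> L * \<epsilon>" using L_nonneg by (rule mult_left_mono)
    then show ?thesis using c[OF \<open>y' \<in> _\<close>] rate_lipschitz[of y' y] by linarith
  qed
  have "q \<in> C" "q' \<in> C" using steers_endpoints 1 3 by blast+
  moreover have c': "0 < c - L * \<epsilon>" using \<epsilon> by simp
  ultimately obtain T\<^sub>2 where 2: "T\<^sub>2 \<le> (q' \<bullet> e - q \<bullet> e) / (c - L * \<epsilon>)" "steers T\<^sub>2 q q'"
    using steers_along_segment[OF _ _ q_height(2) _ rate_q] by blast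
  have "T\<^sub>2 \<le> (\<Delta> + 2 * \<epsilon>) / (c - L * \<epsilon>)"
    using 2(1) divide_right_mono[OF q_height(1), of "c - L * \<epsilon>"] c' by linarith
  then have "T\<^sub>1 + T\<^sub>2 + T\<^sub>3 \<le> U" using 1 3 \<epsilon> by linarith
  moreover have "steers (T\<^sub>1 + T\<^sub>2 + T\<^sub>3) x z" using 1 2 3 steers_trans by blast
  ultimately show thesis using that by blast
qed

lemma continuous_top_rate: "continuous_on {a..b} top_rate"
  using top_rate_lipschitz lipschitz_on_continuous_on by blast

lemma continuous_inverse_top_rate:
  assumes "\<And>r. r \<in> {a..b} \<Longrightarrow> 0 < top_rate r"
  shows "continuous_on {a..b} (\<lambda>r. 1 / top_rate r)"
  using assms by (intro continuous_intros continuous_top_rate) force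

text \<open>Over a short distance, follow the segment from a nearly optimal point of the first slice to the point to which it
  slides in the second slice. Along it the rate falls short of the top rate by \<open>\<eta>\<close> plus
  a multiple of \<open>\<delta>\<close>, which the relative slack \<open>\<kappa>\<close> absorbs because the top rate is bounded away from 0. The slack
  is multiplicative so that the estimates for consecutive distances add up.\<close>
lemma steers_short_distance:
  assumes pos: "\<And>r. r \<in> {a..b} \<Longrightarrow> 0 < top_rate r" and "0 < \<kappa>"
  obtains \<delta> where "0 < \<delta>"
    "\<And>x z. \<lbrakk>x \<in> interior C; z \<in> interior C; x \<bullet> e \<in> {a..b}; z \<bullet> e \<in> {a..b}; x \<bullet> e < z \<bullet> e; z \<bullet> e \<le> x \<bullet> e + \<delta>\<rbrakk>
      \<Longrightarrow> \<exists>T. T \<le> (1 + \<kappa>) * integral {x \<bullet> e..z \<bullet> e} (\<lambda>r. 1 / top_rate r) \<and> steers T x z"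
proof -
  obtain \<rho> where \<rho>: "\<rho> \<in> {a..b}" "\<And>r. r \<in> {a..b} \<Longrightarrow> top_rate \<rho> \<le> top_rate r"
    using continuous_attains_inf[OF compact_Icc _ continuous_top_rate] a_less_b by fastforce
  define m where "m = top_rate \<rho>"
  have "0 < m" using pos[OF \<rho>(1)] by (simp add: m_def)
  obtain K where K: "K-lipschitz_on {a..b} top_rate" using top_rate_lipschitz by blast
  then have "0 \<le> K" by (rule lipschitz_on_nonneg)
  obtain M where "0 \<le> M"
    and M: "\<And>p r. \<lbrakk>p \<in> C; p \<bullet> e \<in> {a..b}; r \<in> {a..b}\<rbrakk>
      \<Longrightarrow> \<exists>p'\<in>C. p' \<bullet> e = r \<and> norm (p' - p) \<le> M * \<bar>r - p \<bullet> e\<bar> \<and> (r \<noteq> p \<bullet> e \<longrightarrow> p' \<in> interior C)"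
    using slide_between_slices by blast
  \<comment> \<open>The inequality top_rate r + K \<delta> < (1 + \<kappa>) (top_rate r - \<eta> - L M \<delta>) is aimed at: its left-hand
    side bounds the top rate on the interval from above, and the bracket bounds the rate on the
    segment from below. The errors A \<delta> and (1 + \<kappa>) \<eta> get a quarter of \<kappa> m each.\<close>
  define A where "A = K + (1 + \<kappa>) * (L * M)"
  have "0 \<le> A" using \<open>0 \<le> K\<close> \<open>0 < \<kappa>\<close> \<open>0 \<le> M\<close> L_nonneg by (simp add: A_def)
  define \<delta> where "\<delta> = \<kappa> * m / (4 * (A + 1))"
  define \<eta> where "\<eta> = \<kappa> * m / (4 * (1 + \<kappa>))"
  have "0 < \<delta>" "0 < \<eta>" using \<open>0 < \<kappa>\<close> \<open>0 < m\<close> \<open>0 \<le> A\<close> by (auto simp: \<delta>_def \<eta>_def)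
  have "A * \<delta> \<le> (A + 1) * \<delta>" using \<open>0 < \<delta>\<close> by simp
  also have "\<dots> = \<kappa> * m / 4" using \<open>0 \<le> A\<close> by (simp add: \<delta>_def field_simps)
  finally have "K * \<delta> + (1 + \<kappa>) * (L * M * \<delta>) \<le> \<kappa> * m / 4" by (simp add: A_def algebra_simps)
  moreover have "(1 + \<kappa>) * \<eta> = \<kappa> * m / 4" using \<open>0 < \<kappa>\<close> by (simp add: \<eta>_def field_simps)
  moreover have "0 < \<kappa> * m" using \<open>0 < \<kappa>\<close> \<open>0 < m\<close> by simp
  ultimately have small: "K * \<delta> + (1 + \<kappa>) * (\<eta> + L * M * \<delta>) < \<kappa> * m" by (simp add: algebra_simps)
  show thesis
  proof (rule that[OF \<open>0 < \<delta>\<close>])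
    fix x z assume xz: "x \<in> interior C" "z \<in> interior C" and x: "x \<bullet> e \<in> {a..b}" and z: "z \<bullet> e \<in> {a..b}"
      and lt: "x \<bullet> e < z \<bullet> e" and le: "z \<bullet> e \<le> x \<bullet> e + \<delta>"
    define h where "h = z \<bullet> e - x \<bullet> e"
    have "0 < h" "h \<le> \<delta>" using lt le by (auto simp: h_def)
    obtain p where p: "p \<in> interior C" "p \<bullet> e = x \<bullet> e" "top_rate (x \<bullet> e) - \<eta> < rate p"
      using top_rate_approx[OF x \<open>0 < \<eta>\<close>] by blast
    then obtain p' where p': "p' \<in> interior C" "p' \<bullet> e = z \<bullet> e" "norm (p' - p) \<le> M * h"
      using M[of p "z \<bullet> e"] x z lt interior_subset[of C] by (auto simp: h_def)
    define c where "c = top_rate (x \<bullet> e) - \<eta> - L * M * \<delta>"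
    have c_le: "c \<le> rate y" if "y \<in> closed_segment p p'" for y
    proof -
      have "norm (p - y) \<le> norm (p' - p)"
        using segment_bound(1)[OF that] by (simp add: norm_minus_commute)
      also have "\<dots> \<le> M * \<delta>"
        using p'(3) mult_left_mono[OF \<open>h \<le> \<delta>\<close> \<open>0 \<le> M\<close>] by linarith
      finally have "L * norm (p - y) \<le> L * (M * \<delta>)" using L_nonneg by (rule mult_left_mono)
      then show ?thesis using rate_lipschitz[of p y] p(3) by (simp add: c_def)
    qed
    have "\<kappa> * m \<le> \<kappa> * top_rate (x \<bullet> e)" using \<rho>(2)[OF x] \<open>0 < \<kappa>\<close> by (simp add: m_def)
    then have c_big: "top_rate (x \<bullet> e) + K * \<delta> < (1 + \<kappa>) * c"
      using small by (simp add: c_def algebra_simps)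
    have top_pos: "0 < top_rate (x \<bullet> e) + K * \<delta>"
      using pos[OF x] \<open>0 \<le> K\<close> \<open>0 < \<delta>\<close> by (simp add: add_pos_nonneg)
    then have "0 < (1 + \<kappa>) * c" using c_big by linarith
    then have "0 < c" using \<open>0 < \<kappa>\<close> by (simp add: zero_less_mult_iff)
    let ?f = "\<lambda>r. 1 / top_rate r"
    have "?f integrable_on {x \<bullet> e..z \<bullet> e}"
      using x z pos
      by (intro integrable_continuous_real continuous_on_subset[OF continuous_inverse_top_rate]) auto
    moreover have "(\<lambda>r. 1 / (top_rate (x \<bullet> e) + K * \<delta>)) integrable_on {x \<bullet> e..z \<bullet> e}"
      by (rule integrable_continuous_real[OF continuous_on_const])
    moreover have "1 / (top_rate (x \<bullet> e) + K * \<delta>) \<le> ?f r" if r: "r \<in> {x \<bullet> e..z \<bullet> e}" for r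
    proof -
      have "r \<in> {a..b}" "\<bar>r - x \<bullet> e\<bar> \<le> \<delta>" using r x z le by auto
      then have "top_rate r \<le> top_rate (x \<bullet> e) + K * \<delta>"
        using lipschitz_onD[OF K \<open>r \<in> {a..b}\<close> x] mult_left_mono[OF _ \<open>0 \<le> K\<close>, of "\<bar>r - x \<bullet> e\<bar>" \<delta>]
        by (simp add: dist_real_def)
      then show ?thesis using pos[OF \<open>r \<in> {a..b}\<close>] by (intro divide_left_mono) auto
    qed
    ultimately have "integral {x \<bullet> e..z \<bullet> e} (\<lambda>r. 1 / (top_rate (x \<bullet> e) + K * \<delta>)) \<le> integral {x \<bullet> e..z \<bullet> e} ?f"
      by (intro integral_le)
    then have int_ge: "h / (top_rate (x \<bullet> e) + K * \<delta>) \<le> integral {x \<bullet> e..z \<bullet> e} ?f"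
      using lt by (simp add: h_def)
    have "(p' \<bullet> e - p \<bullet> e) / c < (1 + \<kappa>) * (h / (top_rate (x \<bullet> e) + K * \<delta>))"
    proof -
      have "h * (top_rate (x \<bullet> e) + K * \<delta>) < h * ((1 + \<kappa>) * c)"
        using c_big \<open>0 < h\<close> by (rule mult_strict_left_mono)
      then show ?thesis
        using \<open>0 < c\<close> top_pos p(2) p'(2) by (simp add: h_def[symmetric] divide_simps mult.commute mult.left_commute)
    qed
    also have "\<dots> \<le> (1 + \<kappa>) * integral {x \<bullet> e..z \<bullet> e} ?f"
      using int_ge \<open>0 < \<kappa>\<close> by (intro mult_left_mono) auto
    finally show "\<exists>T. T \<le> (1 + \<kappa>) * integral {x \<bullet> e..z \<bullet> e} ?f \<and> steers T x z"
      using steers_near_segment[OF xz(1) p(1) p'(1) xz(2) p(2)[symmetric] p'(2)[symmetric] _ \<open>0 < c\<close> c_le]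
        p(2) p'(2) lt by metis
  qed
qed

text \<open>The segment from \<open>x\<^sub>0\<close> to \<open>x\<^sub>1\<close> supplies interior way points at equally spaced heights.\<close>
lemma steers_in_nearly_optimal_time:
  assumes pos: "\<And>r. r \<in> {a..b} \<Longrightarrow> 0 < top_rate r" and "0 < \<kappa>"
  obtains T where "T \<le> (1 + \<kappa>) * integral {a..b} (\<lambda>r. 1 / top_rate r)" "steers T x\<^sub>0 x\<^sub>1"
proof -
  let ?f = "\<lambda>r. 1 / top_rate r"
  obtain \<delta> where "0 < \<delta>"
    and short: "\<And>x z. \<lbrakk>x \<in> interior C; z \<in> interior C; x \<bullet> e \<in> {a..b}; z \<bullet> e \<in> {a..b}; x \<bullet> e < z \<bullet> e; z \<bullet> e \<le> x \<bullet> e + \<delta>\<rbrakk>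
      \<Longrightarrow> \<exists>T. T \<le> (1 + \<kappa>) * integral {x \<bullet> e..z \<bullet> e} ?f \<and> steers T x z"
    using steers_short_distance[OF pos \<open>0 < \<kappa>\<close>] by blast
  obtain N :: nat where "(b - a) / \<delta> < N" using reals_Archimedean2 by blast
  then have "0 < real N" using a_less_b \<open>0 < \<delta>\<close> by (smt (verit) divide_pos_pos)
  have step: "(b - a) / N \<le> \<delta>" using \<open>(b - a) / \<delta> < N\<close> \<open>0 < real N\<close> \<open>0 < \<delta>\<close> by (simp add: field_simps)
  define x where "x k = x\<^sub>0 + (real k / N) *\<^sub>R (x\<^sub>1 - x\<^sub>0)" for k :: nat
  define s where "s = (b - a) / N"
  have "0 < s" "s \<le> \<delta>" "real N * s = b - a" using a_less_b \<open>0 < real N\<close> step by (auto simp: s_def)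
  have x_height: "x k \<bullet> e = a + real k * s" for k
    using x\<^sub>0 x\<^sub>1 by (simp add: x_def s_def inner_simps)
  have x_int: "x k \<in> interior C" if "k \<le> N" for k
  proof -
    have "x k \<in> closed_segment x\<^sub>0 x\<^sub>1"
      unfolding in_segment x_def using that \<open>0 < real N\<close>
      by (intro exI[of _ "real k / N"]) (auto simp: algebra_simps)
    then show ?thesis
      using x\<^sub>0 x\<^sub>1 convex_interior[OF convex_C] closed_segment_subset by blast
  qed
  have x_range: "x k \<bullet> e \<in> {a..b}" if "k \<le> N" for k
  proof -
    have "real k * s \<le> real N * s" using that \<open>0 < s\<close> by (intro mult_right_mono) auto
    then show ?thesis using \<open>0 < s\<close> \<open>real N * s = b - a\<close> by (simp add: x_height)
  qed
  have "\<exists>T. T \<le> (1 + \<kappa>) * integral {a..x k \<bullet> e} ?f \<and> steers T x\<^sub>0 (x k)" if "k \<le> N" for k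
    using that
  proof (induction k)
    case 0
    then show ?case
      using steers_refl[of x\<^sub>0] x\<^sub>0 interior_subset by (auto simp: x_def intro!: exI[of _ 0])
  next
    case (Suc k)
    then obtain T where T: "T \<le> (1 + \<kappa>) * integral {a..x k \<bullet> e} ?f" "steers T x\<^sub>0 (x k)" by auto
    have lt: "x k \<bullet> e < x (Suc k) \<bullet> e" "x (Suc k) \<bullet> e \<le> x k \<bullet> e + \<delta>"
      using \<open>0 < s\<close> \<open>s \<le> \<delta>\<close> by (auto simp: x_height distrib_right)
    then obtain U where U: "U \<le> (1 + \<kappa>) * integral {x k \<bullet> e..x (Suc k) \<bullet> e} ?f" "steers U (x k) (x (Suc k))"
      using short[OF x_int x_int x_range x_range, of k "Suc k"] Suc.prems by auto
    have "integral {a..x k \<bullet> e} ?f + integral {x k \<bullet> e..x (Suc k) \<bullet> e} ?f = integral {a..x (Suc k) \<bullet> e} ?f"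
    proof (rule Henstock_Kurzweil_Integration.integral_combine)
      show "?f integrable_on {a..x (Suc k) \<bullet> e}"
        using x_range[OF Suc.prems] pos
        by (intro integrable_continuous_real continuous_on_subset[OF continuous_inverse_top_rate]) auto
    qed (use x_range[of k] Suc.prems lt in auto)
    then have "T + U \<le> (1 + \<kappa>) * integral {a..x (Suc k) \<bullet> e} ?f"
      using T(1) U(1) by (metis add_mono distrib_left)
    then show ?case using steers_trans[OF T(2) U(2)] by blast
  qed
  from this[OF order_refl] show thesis
    using that \<open>0 < real N\<close> x\<^sub>1 by (auto simp: x_def)
qed

end

section \<open>Lower bounds on the passage time\<close>

context slab_control
begin

text \<open>What the lower bounds use of a solution of the reduced inclusion: its height \<open>w\<close>, as a scalar function.\<close>
definition passes :: "real \<Rightarrow> bool" where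
  "passes T \<longleftrightarrow> 0 \<le> T \<and> (\<exists>w N. abs_continuous 0 T w \<and> negligible N \<and> w 0 = a \<and> w T = b
     \<and> (\<forall>t\<in>{0..T} - N. \<exists>d\<le>top_rate (w t). (w has_real_derivative d) (at t within {0..T})))"

lemma passes_time_lower_bound:
  assumes "passes T" and ab: "a \<le> a'" "a' \<le> b'" "b' \<le> b"
    and \<Phi>: "\<And>r. r \<in> {a'..b'} \<Longrightarrow> (\<Phi> has_real_derivative \<phi> r) (at r within {a'..b'})"
    and \<phi>: "continuous_on {a'..b'} \<phi>" "\<And>r. r \<in> {a'..b'} \<Longrightarrow> 0 \<le> \<phi> r"
      "\<And>r. r \<in> {a'..b'} \<Longrightarrow> \<phi> r * top_rate r \<le> 1"
  shows "\<Phi> b' - \<Phi> a' \<le> T"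
proof -
  obtain w N where w: "0 \<le> T" "abs_continuous 0 T w" "negligible N" "w 0 = a" "w T = b"
    "\<And>t. t \<in> {0..T} - N \<Longrightarrow> \<exists>d\<le>top_rate (w t). (w has_real_derivative d) (at t within {0..T})"
    using \<open>passes T\<close> unfolding passes_def by blast
  show ?thesis
    by (rule reach_time_lower_bound[OF w(1,2) _ ab(2) _ w(3,6) \<Phi> \<phi>]) (use w ab in auto)
qed

lemma passes_time_ge_integral:
  assumes pos: "\<And>r. r \<in> {a..b} \<Longrightarrow> 0 < top_rate r" and "passes T"
  shows "integral {a..b} (\<lambda>r. 1 / top_rate r) \<le> T"
proof -
  note cont = continuous_inverse_top_rate[OF pos]
  have "integral {a..b} (\<lambda>r. 1 / top_rate r) - integral {a..a} (\<lambda>r. 1 / top_rate r) \<le> T"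
  proof (rule passes_time_lower_bound[OF \<open>passes T\<close>,
        where \<Phi> = "\<lambda>u. integral {a..u} (\<lambda>r. 1 / top_rate r)" and \<phi> = "\<lambda>r. 1 / top_rate r"])
    show "((\<lambda>u. integral {a..u} (\<lambda>r. 1 / top_rate r)) has_real_derivative 1 / top_rate r) (at r within {a..b})"
      if "r \<in> {a..b}" for r
      using integral_has_real_derivative[OF cont that] .
    show "1 / top_rate r * top_rate r \<le> 1" "0 \<le> 1 / top_rate r" if "r \<in> {a..b}" for r
      using pos[OF that] by auto
  qed (use cont a_less_b in auto)
  then show ?thesis by simp
qed

text \<open>Near the bad height \<open>r\<^sub>2\<close> the speed is at most \<open>K |r - r\<^sub>2|\<close>, and \<open>1 / |r - r\<^sub>2|\<close> is not integrable. The
  potential \<open>ln (K |r - r\<^sub>2| + \<epsilon>) / K\<close>, with the sign that makes it increasing, has an increment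
  beyond \<open>T\<close> for small \<open>\<epsilon>\<close>. It is used above \<open>r\<^sub>2\<close> if there is room below \<open>b\<close>, and below \<open>r\<^sub>2\<close>
  if \<open>r\<^sub>2 = b\<close>.\<close>
lemma not_passes_if_top_rate_nonpos:
  assumes "r\<^sub>2 \<in> {a..b}" "top_rate r\<^sub>2 \<le> 0"
  shows "\<not> passes T"
proof
  assume "passes T"
  obtain K\<^sub>0 where K\<^sub>0: "K\<^sub>0-lipschitz_on {a..b} top_rate" using top_rate_lipschitz by blast
  define K where "K = K\<^sub>0 + 1"
  have "0 < K" using lipschitz_on_nonneg[OF K\<^sub>0] by (simp add: K_def)
  have K: "top_rate r \<le> K * \<bar>r - r\<^sub>2\<bar>" if "r \<in> {a..b}" for r
  proof -
    have "top_rate r \<le> K\<^sub>0 * \<bar>r - r\<^sub>2\<bar>"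
      using lipschitz_onD[OF K\<^sub>0 that assms(1)] assms(2) by (simp add: dist_real_def)
    also have "\<dots> \<le> K * \<bar>r - r\<^sub>2\<bar>" by (simp add: K_def mult_right_mono)
    finally show ?thesis .
  qed
  have slow: "(ln (K * h + \<epsilon>) - ln \<epsilon>) / K \<le> T" if "0 < \<epsilon>" "h = (if r\<^sub>2 < b then b - r\<^sub>2 else b - a)" for \<epsilon> h
  proof (cases "r\<^sub>2 < b")
    case True
    have "ln (K * (b - r\<^sub>2) + \<epsilon>) / K - ln (K * (r\<^sub>2 - r\<^sub>2) + \<epsilon>) / K \<le> T"
    proof (rule passes_time_lower_bound[OF \<open>passes T\<close>,
          where \<Phi> = "\<lambda>r. ln (K * (r - r\<^sub>2) + \<epsilon>) / K" and \<phi> = "\<lambda>r. 1 / (K * (r - r\<^sub>2) + \<epsilon>)"])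
      fix r assume r: "r \<in> {r\<^sub>2..b}"
      then have pos: "0 < K * (r - r\<^sub>2) + \<epsilon>" using \<open>0 < K\<close> \<open>0 < \<epsilon>\<close> by (simp add: add_nonneg_pos)
      then show "((\<lambda>r. ln (K * (r - r\<^sub>2) + \<epsilon>) / K) has_real_derivative 1 / (K * (r - r\<^sub>2) + \<epsilon>)) (at r within {r\<^sub>2..b})"
        using \<open>0 < K\<close> pos by (auto intro!: derivative_eq_intros)
      show "0 \<le> 1 / (K * (r - r\<^sub>2) + \<epsilon>)" using pos by simp
      show "1 / (K * (r - r\<^sub>2) + \<epsilon>) * top_rate r \<le> 1"
        using K[of r] r assms(1) pos \<open>0 < \<epsilon>\<close> by (simp add: field_simps)
    next
      have "K * (r - r\<^sub>2) + \<epsilon> \<noteq> 0" if "r \<in> {r\<^sub>2..b}" for r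
        using that \<open>0 < K\<close> \<open>0 < \<epsilon>\<close> by (simp add: add_nonneg_pos less_imp_neq[symmetric])
      then show "continuous_on {r\<^sub>2..b} (\<lambda>r. 1 / (K * (r - r\<^sub>2) + \<epsilon>))" by (intro continuous_intros) auto
    qed (use assms(1) in auto)
    then show ?thesis using True that by (simp add: diff_divide_distrib)
  next
    case False
    then have r\<^sub>2: "r\<^sub>2 = b" using assms(1) by simp
    have "- ln (K * (b - b) + \<epsilon>) / K - (- ln (K * (b - a) + \<epsilon>) / K) \<le> T"
    proof (rule passes_time_lower_bound[OF \<open>passes T\<close>,
          where \<Phi> = "\<lambda>r. - ln (K * (b - r) + \<epsilon>) / K" and \<phi> = "\<lambda>r. 1 / (K * (b - r) + \<epsilon>)"])
      fix r assume r: "r \<in> {a..b}"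
      then have pos: "0 < K * (b - r) + \<epsilon>" using \<open>0 < K\<close> \<open>0 < \<epsilon>\<close> by (simp add: add_nonneg_pos)
      then show "((\<lambda>r. - ln (K * (b - r) + \<epsilon>) / K) has_real_derivative 1 / (K * (b - r) + \<epsilon>)) (at r within {a..b})"
        using \<open>0 < K\<close> pos by (auto intro!: derivative_eq_intros)
      show "0 \<le> 1 / (K * (b - r) + \<epsilon>)" using pos by simp
      show "1 / (K * (b - r) + \<epsilon>) * top_rate r \<le> 1"
        using K[of r] r r\<^sub>2 pos \<open>0 < \<epsilon>\<close> by (simp add: field_simps)
    next
      have "K * (b - r) + \<epsilon> \<noteq> 0" if "r \<in> {a..b}" for r
        using that \<open>0 < K\<close> \<open>0 < \<epsilon>\<close> by (simp add: add_nonneg_pos less_imp_neq[symmetric])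
      then show "continuous_on {a..b} (\<lambda>r. 1 / (K * (b - r) + \<epsilon>))" by (intro continuous_intros) auto
    qed (use a_less_b in auto)
    then show ?thesis using False that by (simp add: diff_divide_distrib)
  qed
  define h where "h = (if r\<^sub>2 < b then b - r\<^sub>2 else b - a)"
  have "0 < h" using a_less_b by (simp add: h_def)
  \<comment> \<open>With this \<epsilon> the increment of the potential is ln (exp (K T) + 1) / K, just above T.\<close>
  define \<epsilon> where "\<epsilon> = K * h / exp (K * T)"
  have "0 < \<epsilon>" using \<open>0 < K\<close> \<open>0 < h\<close> by (simp add: \<epsilon>_def)
  have "K * h + \<epsilon> = \<epsilon> * (exp (K * T) + 1)" by (simp add: \<epsilon>_def field_simps)
  then have "ln (K * h + \<epsilon>) - ln \<epsilon> = ln (exp (K * T) + 1)"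
    using \<open>0 < \<epsilon>\<close> by (simp add: ln_mult add_pos_pos less_imp_neq[symmetric])
  also have "\<dots> > ln (exp (K * T))" by (subst ln_less_cancel_iff) (auto simp: add_pos_pos)
  finally have "K * T < ln (K * h + \<epsilon>) - ln \<epsilon>" by simp
  moreover have "ln (K * h + \<epsilon>) - ln \<epsilon> \<le> K * T"
    using slow[OF \<open>0 < \<epsilon>\<close> h_def] \<open>0 < K\<close> by (simp add: pos_divide_le_eq mult.commute)
  ultimately show False by simp
qed

end

section \<open>The control system when H is a line\<close>

lemma line_eq_span:
  fixes H :: "'a::euclidean_space set"
  assumes "dim H = 1" "e \<in> H" "norm e = 1" "subspace H"
  shows "H = span {e}"
proof
  have "independent {e}" using assms(3) by (auto simp: independent_insert)
  then show "H \<subseteq> span {e}"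
    using assms by (intro card_ge_dim_independent) auto
  show "span {e} \<subseteq> H" using assms by (intro span_minimal) auto
qed

lemma orthogonal_comp_span_singleton: "(span {e})\<^sup>\<bottom> = {v. v \<bullet> e = 0}"
  by (auto simp: orthogonal_comp_def orthogonal_def span_singleton inner_commute)

lemma orth_proj_line:
  assumes "norm e = 1"
  shows "orth_proj (span {e}) y = (y \<bullet> e) *\<^sub>R e"
  unfolding orth_proj_def
proof (rule the_equality)
  have ee: "e \<bullet> e = 1" using assms by (simp add: norm_eq_1)
  have "(y \<bullet> e) *\<^sub>R e \<in> span {e}" by (simp add: span_mul span_base)
  moreover have "y - (y \<bullet> e) *\<^sub>R e \<in> (span {e})\<^sup>\<bottom>"
    using ee by (simp add: orthogonal_comp_span_singleton inner_diff_left)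
  ultimately show "(y \<bullet> e) *\<^sub>R e \<in> span {e} \<and> y - (y \<bullet> e) *\<^sub>R e \<in> (span {e})\<^sup>\<bottom>" ..
  fix p assume "p \<in> span {e} \<and> y - p \<in> (span {e})\<^sup>\<bottom>"
  then have "p \<in> span {e}" and perp: "(y - p) \<bullet> e = 0"
    by (simp_all only: orthogonal_comp_span_singleton mem_Collect_eq)
  then obtain c where "p = c *\<^sub>R e" by (auto simp only: span_singleton)
  then show "p = (y \<bullet> e) *\<^sub>R e" using perp ee by (simp add: inner_diff_left)
qed

text \<open>Explicit null sets are what the gauge argument of \<open>abs_continuous_increment_le\<close> needs.\<close>
lemma AE_lebesgue_on_iff_negligible:
  fixes S :: "real set"
  assumes "S \<in> sets lebesgue"
  shows "(AE t in lebesgue_on S. P t) \<longleftrightarrow> (\<exists>N. negligible N \<and> (\<forall>t\<in>S - N. P t))"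
proof -
  have "(AE t in lebesgue_on S. P t) \<longleftrightarrow> (AE t in lebesgue. t \<in> S \<longrightarrow> P t)"
    using assms by (subst AE_restrict_space_iff) auto
  also have "\<dots> \<longleftrightarrow> (\<exists>N. negligible N \<and> (\<forall>t\<in>S - N. P t))"
  proof
    assume "AE t in lebesgue. t \<in> S \<longrightarrow> P t"
    then obtain N where "N \<in> null_sets lebesgue" "{t \<in> space lebesgue. \<not> (t \<in> S \<longrightarrow> P t)} \<subseteq> N"
      unfolding eventually_ae_filter by blast
    then show "\<exists>N. negligible N \<and> (\<forall>t\<in>S - N. P t)"
      unfolding negligible_iff_null_sets by (intro exI[of _ N]) auto
  next
    assume "\<exists>N. negligible N \<and> (\<forall>t\<in>S - N. P t)"
    then show "AE t in lebesgue. t \<in> S \<longrightarrow> P t"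
      unfolding negligible_iff_null_sets by (auto intro: AE_I')
  qed
  finally show ?thesis .
qed

lemma SUP_mult_const:
  fixes f :: "'b \<Rightarrow> real"
  assumes "A \<noteq> {}" "bdd_above (f ` A)" "0 < n"
  shows "(SUP y\<in>A. f y * n) = (SUP y\<in>A. f y) * n"
proof (rule antisym)
  show "(SUP y\<in>A. f y * n) \<le> (SUP y\<in>A. f y) * n"
    using assms by (intro cSUP_least mult_right_mono cSUP_upper) auto
  obtain M where "\<And>y. y \<in> A \<Longrightarrow> f y \<le> M" using assms(2) unfolding bdd_above_def by auto
  then have "bdd_above ((\<lambda>y. f y * n) ` A)"
    using assms(3) by (intro bdd_aboveI[of _ "M * n"]) auto
  then have "f y \<le> (SUP y\<in>A. f y * n) / n" if "y \<in> A" for y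
    using cSUP_upper[OF that, of "\<lambda>y. f y * n"] assms(3) by (simp add: field_simps)
  then have "(SUP y\<in>A. f y) \<le> (SUP y\<in>A. f y * n) / n" by (rule cSUP_least[OF assms(1)])
  then show "(SUP y\<in>A. f y) * n \<le> (SUP y\<in>A. f y * n)" using assms(3) by (simp add: field_simps)
qed

text \<open>The data of the control system with \<open>H\<close> spanned by the unit vector \<open>e\<close>, oriented so that \<open>y\<^sub>1\<close> lies higher
  than \<open>y\<^sub>0\<close>.\<close>
locale line_control =
  fixes F :: "real^'n \<Rightarrow> real^'n" and B :: "real^'m^'n" and L :: real and C :: "(real^'n) set"
    and y\<^sub>0 y\<^sub>1 e :: "real^'n"
  assumes lip: "L-lipschitz_on UNIV F" and bounded_C: "bounded C" and convex_C: "convex C"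
    and y\<^sub>0: "y\<^sub>0 \<in> interior C" and y\<^sub>1: "y\<^sub>1 \<in> interior C"
    and unit: "norm e = 1" and H: "H_space B = span {e}" and heights: "y\<^sub>0 \<bullet> e < y\<^sub>1 \<bullet> e"
begin

sublocale slab_control F L e C y\<^sub>0 y\<^sub>1 "y\<^sub>0 \<bullet> e" "y\<^sub>1 \<bullet> e"
  by unfold_locales (use lip bounded_C convex_C y\<^sub>0 y\<^sub>1 unit heights in auto)

lemma ee: "e \<bullet> e = 1" using unit by (simp add: norm_eq_1)

lemma proj: "orth_proj (H_space B) y = (y \<bullet> e) *\<^sub>R e"
  using unit by (simp add: H orth_proj_line)

lemma lipschitz_height: "1-lipschitz_on UNIV (\<lambda>y. y \<bullet> e)"
proof (rule lipschitz_onI)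
  fix y z :: "real^'n"
  have "\<bar>(y - z) \<bullet> e\<bar> \<le> norm (y - z)" using Cauchy_Schwarz_ineq2[of "y - z" e] unit by simp
  then show "dist (y \<bullet> e) (z \<bullet> e) \<le> 1 * dist y z" by (simp add: dist_norm inner_diff_left)
qed simp

lemma F_H_eq: "F_H F B y = rate y *\<^sub>R e"
  by (simp add: F_H_def proj rate_def)

text \<open>In finite dimension the orthogonal complement of \<open>H\<close> is again the range of \<open>B\<close>; so every velocity orthogonal
  to \<open>e\<close> comes from a control.\<close>
lemma range_B: "range (\<lambda>u. B *v u) = {v. v \<bullet> e = 0}"
proof -
  have "subspace (range (\<lambda>u. B *v u))"
    by (intro linear_subspace_image subspace_UNIV matrix_vector_mul_linear)
  then have "range (\<lambda>u. B *v u) = (H_space B)\<^sup>\<bottom>"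
    by (simp add: H_space_def orthogonal_comp_self)
  then show ?thesis by (simp add: H orthogonal_comp_span_singleton)
qed

lemma fibre_eq: "fibre B C (r *\<^sub>R e) = {y \<in> C. y \<bullet> e = r}"
proof -
  have "y \<in> (\<lambda>k. r *\<^sub>R e + k) ` {v. v \<bullet> e = 0} \<longleftrightarrow> y \<bullet> e = r" for y
    using ee by (auto simp: inner_simps intro!: image_eqI[of _ _ "y - r *\<^sub>R e"])
  then show ?thesis by (auto simp: fibre_def H orthogonal_comp_span_singleton)
qed

lemma speed_eq_top_rate:
  assumes "r \<in> {y\<^sub>0 \<bullet> e..y\<^sub>1 \<bullet> e}"
  shows "speed F B C (r *\<^sub>R e) ((y\<^sub>0 \<bullet> e) *\<^sub>R e) ((y\<^sub>1 \<bullet> e) *\<^sub>R e) = top_rate r"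
proof -
  define n where "n = y\<^sub>1 \<bullet> e - y\<^sub>0 \<bullet> e"
  have "0 < n" using heights by (simp add: n_def)
  have diff: "(y\<^sub>1 \<bullet> e) *\<^sub>R e - (y\<^sub>0 \<bullet> e) *\<^sub>R e = n *\<^sub>R e" by (simp add: n_def algebra_simps)
  obtain m where "m \<in> interior C" "m \<bullet> e = r" using interior_slice_nonempty[OF assms] .
  then have ne: "{y \<in> C. y \<bullet> e = r} \<noteq> {}" using interior_subset by blast
  have "(SUP x\<in>F_H F B ` fibre B C (r *\<^sub>R e). x \<bullet> (n *\<^sub>R e)) = (SUP y\<in>{y \<in> C. y \<bullet> e = r}. rate y * n)"
    by (simp add: fibre_eq image_image F_H_eq ee mult.commute)
  also have "\<dots> = top_rate r * n"
    unfolding top_rate_def by (rule SUP_mult_const[OF ne bdd_above_rate \<open>0 < n\<close>])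
  finally show ?thesis using \<open>0 < n\<close> unit by (simp add: speed_def diff)
qed

abbreviation admissible_times :: "real set" where
  "admissible_times \<equiv> {T. 0 < T \<and> (\<exists>u y. Linfty_on T u \<and> control_solution F B T u y
        \<and> y 0 = y\<^sub>0 \<and> y T = y\<^sub>1 \<and> (\<forall>t\<in>{0..T}. y t \<in> C))}"

abbreviation reduced_times :: "real set" where
  "reduced_times \<equiv> {T. 0 < T \<and> (\<exists>z. (\<forall>t\<in>{0..T}. z t \<in> H_space B) \<and> inclusion_solution F B C T z
        \<and> z 0 = orth_proj (H_space B) y\<^sub>0 \<and> z T = orth_proj (H_space B) y\<^sub>1
        \<and> (\<forall>t\<in>{0..T}. z t \<in> orth_proj (H_space B) ` C))}"

text \<open>The projection of an admissible trajectory to \<open>H\<close> solves the reduced inclusion, because the control term is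
  orthogonal to \<open>e\<close> and drops out.\<close>
lemma admissible_subset_reduced: "admissible_times \<subseteq> reduced_times"
proof
  fix T assume "T \<in> admissible_times"
  then obtain u y where "0 < T" and sol: "control_solution F B T u y"
    and ends: "y 0 = y\<^sub>0" "y T = y\<^sub>1" and y_C: "\<forall>t\<in>{0..T}. y t \<in> C"
    unfolding mem_Collect_eq by (elim conjE exE)
  define z where "z t = orth_proj (H_space B) (y t)" for t
  have z: "z = (\<lambda>t. (y t \<bullet> e) *\<^sub>R e)" by (simp add: z_def proj fun_eq_iff)
  have "1-lipschitz_on UNIV (\<lambda>y. (y \<bullet> e) *\<^sub>R e)"
    using lipschitz_height unit
    by (simp add: lipschitz_on_def dist_norm flip: scaleR_diff_left)
  moreover have "abs_continuous 0 T y" using sol by (simp add: control_solution_def)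
  ultimately have "abs_continuous 0 T z"
    unfolding z using abs_continuous_compose_lipschitz by blast
  moreover have "AE t in lebesgue_on {0..T}. \<exists>v\<in>F_H F B ` fibre B C (z t).
          (z has_vector_derivative v) (at t within {0..T})"
  proof -
    obtain N where N: "negligible N"
      "\<And>t. t \<in> {0..T} - N \<Longrightarrow> (y has_vector_derivative F (y t) + B *v u t) (at t within {0..T})"
      using sol by (auto simp: control_solution_def AE_lebesgue_on_iff_negligible)
    have "\<exists>v\<in>F_H F B ` fibre B C (z t). (z has_vector_derivative v) (at t within {0..T})"
      if t: "t \<in> {0..T} - N" for t
    proof
      have "(B *v u t) \<bullet> e = 0" using range_B by blast
      moreover have "((\<lambda>t. (y t \<bullet> e) *\<^sub>R e) has_vector_derivative ((F (y t) + B *v u t) \<bullet> e) *\<^sub>R e) (at t within {0..T})"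
        using bounded_linear.has_vector_derivative[OF _ N(2)[OF t], of "\<lambda>x. (x \<bullet> e) *\<^sub>R e"]
        by (simp add: bounded_linear_scaleR_const bounded_linear_inner_left)
      ultimately show "(z has_vector_derivative F_H F B (y t)) (at t within {0..T})"
        by (simp add: z F_H_eq rate_def inner_add_left)
      show "F_H F B (y t) \<in> F_H F B ` fibre B C (z t)"
        using y_C t by (intro imageI) (auto simp: z fibre_eq)
    qed
    then show ?thesis using N(1) by (auto simp: AE_lebesgue_on_iff_negligible)
  qed
  moreover have "z t \<in> H_space B" for t by (simp add: z H span_mul span_base)
  ultimately have "inclusion_solution F B C T z" "\<forall>t\<in>{0..T}. z t \<in> H_space B"
    by (simp_all add: inclusion_solution_def)
  moreover have "z 0 = orth_proj (H_space B) y\<^sub>0" "z T = orth_proj (H_space B) y\<^sub>1"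
    using ends by (simp_all add: z_def)
  moreover have "\<forall>t\<in>{0..T}. z t \<in> orth_proj (H_space B) ` C" using y_C by (simp add: z_def)
  ultimately show "T \<in> reduced_times"
    unfolding mem_Collect_eq using \<open>0 < T\<close> by (intro conjI exI[of _ z])
qed

lemma reduced_times_passes:
  assumes "T \<in> reduced_times"
  shows "passes T"
proof -
  obtain z where "0 < T" and ac: "abs_continuous 0 T z"
    and ae: "AE t in lebesgue_on {0..T}. \<exists>v\<in>F_H F B ` fibre B C (z t). (z has_vector_derivative v) (at t within {0..T})"
    and ends: "z 0 = (y\<^sub>0 \<bullet> e) *\<^sub>R e" "z T = (y\<^sub>1 \<bullet> e) *\<^sub>R e"
    and zH: "\<And>t. t \<in> {0..T} \<Longrightarrow> z t \<in> span {e}"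
  proof -
    from assms obtain z where z: "0 < T" "\<forall>t\<in>{0..T}. z t \<in> H_space B" "inclusion_solution F B C T z"
      "z 0 = orth_proj (H_space B) y\<^sub>0" "z T = orth_proj (H_space B) y\<^sub>1"
      unfolding mem_Collect_eq by (elim conjE exE)
    show thesis
    proof (rule that[of z])
      show "z t \<in> span {e}" if "t \<in> {0..T}" for t using z(2) that H by auto
    qed (use z in \<open>auto simp: inclusion_solution_def proj\<close>)
  qed
  obtain N where N: "negligible N"
    "\<And>t. t \<in> {0..T} - N \<Longrightarrow> \<exists>v\<in>F_H F B ` fibre B C (z t). (z has_vector_derivative v) (at t within {0..T})"
    using ae by (auto simp: AE_lebesgue_on_iff_negligible)
  have "abs_continuous 0 T (\<lambda>t. z t \<bullet> e)"
    by (rule abs_continuous_compose_lipschitz[OF ac lipschitz_height subset_UNIV])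
  moreover have "\<exists>d\<le>top_rate (z t \<bullet> e). ((\<lambda>t. z t \<bullet> e) has_real_derivative d) (at t within {0..T})"
    if t: "t \<in> {0..T} - N" for t
  proof -
    obtain y where y: "y \<in> fibre B C (z t)" "(z has_vector_derivative F_H F B y) (at t within {0..T})"
      using N(2)[OF t] by blast
    have zt: "z t = (z t \<bullet> e) *\<^sub>R e"
      using zH[of t] t ee by (auto simp: span_singleton)
    then have "y \<in> C" "y \<bullet> e = z t \<bullet> e" using y(1) fibre_eq[of "z t \<bullet> e"] by auto
    then have "rate y \<le> top_rate (z t \<bullet> e)" using rate_le_top_rate by metis
    moreover have "((\<lambda>t. z t \<bullet> e) has_real_derivative rate y) (at t within {0..T})"
      using bounded_linear.has_vector_derivative[OF bounded_linear_inner_left y(2), of e]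
      by (simp add: F_H_eq ee has_real_derivative_iff_has_vector_derivative)
    ultimately show ?thesis by blast
  qed
  ultimately show ?thesis
    unfolding passes_def using \<open>0 < T\<close> N(1) ends ee
    by (intro conjI exI[of _ "\<lambda>t. z t \<bullet> e"] exI[of _ N]) auto
qed

text \<open>A linear right inverse of \<open>B\<close> on its range turns the velocity into a control and preserves boundedness and
  measurability.\<close>
lemma steers_admissible:
  assumes "steers T y\<^sub>0 y\<^sub>1"
  shows "T \<in> admissible_times"
proof -
  obtain y v S K where y: "0 \<le> T" "K-lipschitz_on {0..T} y" "v \<in> borel_measurable borel"
      "bounded (range v)" "\<And>t. v t \<bullet> e = 0" "finite S"
      "\<And>t. t \<in> {0..T} - S \<Longrightarrow> (y has_vector_derivative F (y t) + v t) (at t within {0..T})"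
      "y ` {0..T} \<subseteq> C" "y 0 = y\<^sub>0" "y T = y\<^sub>1"
    using assms unfolding steers_def by metis
  have "T \<noteq> 0" using y heights by auto
  obtain g where "linear g" and g: "\<And>v. v \<in> range (\<lambda>u. B *v u) \<Longrightarrow> B *v g v = v"
    using linear_exists_right_inverse_on[OF matrix_vector_mul_linear subspace_UNIV, of B] by blast
  define u where "u t = g (v t)" for t
  have Bu: "B *v u t = v t" for t using g y(5) by (simp add: u_def range_B)
  have "bounded_linear g" using \<open>linear g\<close> by (rule linear_conv_bounded_linear[THEN iffD1])
  have "u \<in> borel_measurable borel"
    unfolding u_def
    by (rule borel_measurable_continuous_on[OF linear_continuous_on[OF \<open>bounded_linear g\<close>] y(3)])
  then have "u \<in> borel_measurable (lebesgue_on {0..T})"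
    by (intro measurable_restrict_space1 measurable_completion) simp
  moreover have "\<exists>K. AE t in lebesgue_on {0..T}. norm (u t) \<le> K"
  proof -
    have "bounded (range u)"
      using bounded_linear_image[OF y(4) \<open>bounded_linear g\<close>] by (simp add: u_def image_image)
    then obtain K where "\<And>t. norm (u t) \<le> K" unfolding bounded_iff by blast
    then show ?thesis by (intro exI[of _ K]) simp
  qed
  moreover have "control_solution F B T u y"
    unfolding control_solution_def
  proof
    show "abs_continuous 0 T y" using y(2) by (rule lipschitz_imp_abs_continuous)
    show "AE t in lebesgue_on {0..T}. (y has_vector_derivative F (y t) + B *v u t) (at t within {0..T})"
      using y(6,7) negligible_finite by (auto simp: AE_lebesgue_on_iff_negligible Bu)
  qed
  ultimately have "Linfty_on T u" "control_solution F B T u y" by (simp_all add: Linfty_on_def)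
  then show ?thesis
    unfolding mem_Collect_eq using y(1,8-10) \<open>T \<noteq> 0\<close>
    by (intro conjI exI[of _ u] exI[of _ y]) auto
qed


lemma min_time_eq: "min_time F B C y\<^sub>0 y\<^sub>1 = (INF T\<in>admissible_times. ereal T)"
  by (simp add: min_time_def)

lemma reduced_min_time_eq: "reduced_min_time F B C y\<^sub>0 y\<^sub>1 = (INF T\<in>reduced_times. ereal T)"
  by (simp add: reduced_min_time_def)

lemma reduced_min_time_le: "reduced_min_time F B C y\<^sub>0 y\<^sub>1 \<le> min_time F B C y\<^sub>0 y\<^sub>1"
  unfolding min_time_eq reduced_min_time_eq by (rule INF_superset_mono[OF admissible_subset_reduced]) simp

lemma min_times_if_top_rate_pos:
  assumes pos: "\<And>r. r \<in> {y\<^sub>0 \<bullet> e..y\<^sub>1 \<bullet> e} \<Longrightarrow> 0 < top_rate r"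
  defines "I \<equiv> integral {y\<^sub>0 \<bullet> e..y\<^sub>1 \<bullet> e} (\<lambda>r. 1 / top_rate r)"
  shows "min_time F B C y\<^sub>0 y\<^sub>1 = ereal I" "reduced_min_time F B C y\<^sub>0 y\<^sub>1 = ereal I"
proof -
  have "0 \<le> I"
    unfolding I_def using pos
    by (intro integral_nonneg integrable_continuous_real continuous_inverse_top_rate) (auto intro: less_imp_le)
  have lower: "ereal I \<le> reduced_min_time F B C y\<^sub>0 y\<^sub>1"
    unfolding reduced_min_time_eq I_def
    using passes_time_ge_integral[OF pos reduced_times_passes] by (intro INF_greatest) simp
  have upper: "min_time F B C y\<^sub>0 y\<^sub>1 \<le> ereal I"
  proof (rule ereal_le_epsilon2)
    fix \<epsilon> :: real assume "0 < \<epsilon>"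
    define \<kappa> where "\<kappa> = \<epsilon> / (I + 1)"
    have "0 < \<kappa>" using \<open>0 < \<epsilon>\<close> \<open>0 \<le> I\<close> by (simp add: \<kappa>_def)
    then obtain T where T: "T \<le> (1 + \<kappa>) * I" "steers T y\<^sub>0 y\<^sub>1"
      unfolding I_def using steers_in_nearly_optimal_time[OF pos] by blast
    have "min_time F B C y\<^sub>0 y\<^sub>1 \<le> ereal T"
      unfolding min_time_eq using steers_admissible[OF T(2)] by (rule INF_lower)
    moreover have "T \<le> I + \<kappa> * (I + 1)" using T(1) \<open>0 < \<kappa>\<close> by (simp add: algebra_simps)
    then have "ereal T \<le> ereal I + ereal \<epsilon>" using \<open>0 \<le> I\<close> by (simp add: \<kappa>_def)
    ultimately show "min_time F B C y\<^sub>0 y\<^sub>1 \<le> ereal I + ereal \<epsilon>" by (rule order_trans)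
  qed
  show "min_time F B C y\<^sub>0 y\<^sub>1 = ereal I" "reduced_min_time F B C y\<^sub>0 y\<^sub>1 = ereal I"
    using lower upper reduced_min_time_le by (auto intro: antisym order_trans)
qed

lemma min_times_if_top_rate_nonpos:
  assumes "r \<in> {y\<^sub>0 \<bullet> e..y\<^sub>1 \<bullet> e}" "top_rate r \<le> 0"
  shows "min_time F B C y\<^sub>0 y\<^sub>1 = \<infinity>" "reduced_min_time F B C y\<^sub>0 y\<^sub>1 = \<infinity>"
proof -
  have empty: "reduced_times = {}"
    using reduced_times_passes not_passes_if_top_rate_nonpos[OF assms] by blast
  then show "reduced_min_time F B C y\<^sub>0 y\<^sub>1 = \<infinity>"
    unfolding reduced_min_time_eq empty by (simp add: top_ereal_def)
  then show "min_time F B C y\<^sub>0 y\<^sub>1 = \<infinity>" using reduced_min_time_le by simp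
qed

end

theorem theorem3p4:
  fixes F :: "real^'n \<Rightarrow> real^'n" and B :: "real^'m^'n" and C :: "(real^'n) set"
    and L_F :: real and y\<^sub>0 y\<^sub>1 h\<^sub>0 h\<^sub>1 :: "real^'n"
  assumes "CARD('m) < CARD('n)"
    and "L_F > 0" and "L_F-lipschitz_on UNIV F"
    and "rank B = CARD('m)"
    and "bounded C" and "convex C" and "interior C \<noteq> {}" and "C1_boundary C"
    and "measurable_selection F B C"
    and "dim (H_space B) = 1"
    and "y\<^sub>0 \<in> interior C" and "y\<^sub>1 \<in> interior C"
    and "h\<^sub>0 = orth_proj (H_space B) y\<^sub>0" and "h\<^sub>1 = orth_proj (H_space B) y\<^sub>1"
    and "h\<^sub>0 \<noteq> h\<^sub>1"
  shows
    "((\<forall>h\<in>closed_segment h\<^sub>0 h\<^sub>1. speed F B C h h\<^sub>0 h\<^sub>1 > 0) \<longrightarrow>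
        min_time F B C y\<^sub>0 y\<^sub>1 = reduced_min_time F B C y\<^sub>0 y\<^sub>1
      \<and> min_time F B C y\<^sub>0 y\<^sub>1 < \<infinity>
      \<and> arclength_integrable h\<^sub>0 h\<^sub>1 (\<lambda>h. 1 / speed F B C h h\<^sub>0 h\<^sub>1)
      \<and> min_time F B C y\<^sub>0 y\<^sub>1 =
          ereal (arclength_integral h\<^sub>0 h\<^sub>1 (\<lambda>h. 1 / speed F B C h h\<^sub>0 h\<^sub>1)))
   \<and> ((\<exists>h\<^sub>2\<in>closed_segment h\<^sub>0 h\<^sub>1. speed F B C h\<^sub>2 h\<^sub>0 h\<^sub>1 \<le> 0) \<longrightarrow>
        min_time F B C y\<^sub>0 y\<^sub>1 = \<infinity> \<and> reduced_min_time F B C y\<^sub>0 y\<^sub>1 = \<infinity>)"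
proof -
  let ?H = "H_space B"
  have sub: "subspace ?H" unfolding H_space_def by (rule subspace_orthogonal_comp)
  have "\<not> ?H \<subseteq> {0}"
  proof
    assume "?H \<subseteq> {0}"
    then have "dim ?H = 0" by (simp only: dim_eq_0)
    then show False using assms(10) by simp
  qed
  then obtain x where "x \<in> ?H" "x \<noteq> 0" by blast
  define e\<^sub>0 where "e\<^sub>0 = sgn x"
  have e\<^sub>0: "e\<^sub>0 \<in> ?H" "norm e\<^sub>0 = 1"
    using \<open>x \<in> ?H\<close> \<open>x \<noteq> 0\<close> subspace_scale[OF sub] by (auto simp: e\<^sub>0_def sgn_div_norm norm_sgn)
  have H\<^sub>0: "?H = span {e\<^sub>0}" by (rule line_eq_span[OF assms(10) e\<^sub>0 sub])
  have "y\<^sub>0 \<bullet> e\<^sub>0 \<noteq> y\<^sub>1 \<bullet> e\<^sub>0"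
    using assms(13-15) by (auto simp: H\<^sub>0 orth_proj_line[OF e\<^sub>0(2)])
  \<comment> \<open>The unit vector of H is only determined up to its sign, which is chosen so that it points from
    \<open>h\<^sub>0\<close> to \<open>h\<^sub>1\<close>.\<close>
  define e where "e = sgn (y\<^sub>1 \<bullet> e\<^sub>0 - y\<^sub>0 \<bullet> e\<^sub>0) *\<^sub>R e\<^sub>0"
  have e: "e \<in> ?H" "norm e = 1"
    using e\<^sub>0 subspace_scale[OF sub] \<open>y\<^sub>0 \<bullet> e\<^sub>0 \<noteq> y\<^sub>1 \<bullet> e\<^sub>0\<close> by (auto simp: e_def abs_sgn_eq)
  have "y\<^sub>1 \<bullet> e - y\<^sub>0 \<bullet> e = \<bar>y\<^sub>1 \<bullet> e\<^sub>0 - y\<^sub>0 \<bullet> e\<^sub>0\<bar>"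
    by (simp add: e_def abs_sgn algebra_simps)
  then have heights: "y\<^sub>0 \<bullet> e < y\<^sub>1 \<bullet> e" using \<open>y\<^sub>0 \<bullet> e\<^sub>0 \<noteq> y\<^sub>1 \<bullet> e\<^sub>0\<close> by simp
  interpret line_control F B L_F C y\<^sub>0 y\<^sub>1 e
    by unfold_locales (use assms e heights line_eq_span[OF assms(10) e sub] in auto)
  define a b where "a = y\<^sub>0 \<bullet> e" and "b = y\<^sub>1 \<bullet> e"
  have h: "h\<^sub>0 = a *\<^sub>R e" "h\<^sub>1 = b *\<^sub>R e" by (simp_all add: assms(13,14) proj a_def b_def)
  have "a < b" using heights by (simp add: a_def b_def)
  have diff: "h\<^sub>1 - h\<^sub>0 = (b - a) *\<^sub>R e" by (simp add: h scaleR_diff_left)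
  then have len: "norm (h\<^sub>1 - h\<^sub>0) = b - a" and dir: "sgn (h\<^sub>1 - h\<^sub>0) = e"
    using \<open>a < b\<close> unit by (auto simp: sgn_div_norm)
  have speed: "speed F B C (r *\<^sub>R e) h\<^sub>0 h\<^sub>1 = top_rate r" if "r \<in> {a..b}" for r
    using speed_eq_top_rate[of r] that by (simp add: h a_def b_def)
  have seg: "closed_segment h\<^sub>0 h\<^sub>1 = (\<lambda>r. r *\<^sub>R e) ` {a..b}"
    using closed_segment_linear_image[of "\<lambda>r. r *\<^sub>R e" a b] \<open>a < b\<close>
    by (simp add: h linear_scaleR_left closed_segment_eq_real_ivl)
  show ?thesis
  proof (intro conjI impI)
    assume pos: "\<forall>h\<in>closed_segment h\<^sub>0 h\<^sub>1. speed F B C h h\<^sub>0 h\<^sub>1 > 0"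
    then have top_pos: "\<And>r. r \<in> {y\<^sub>0 \<bullet> e..y\<^sub>1 \<bullet> e} \<Longrightarrow> 0 < top_rate r"
      using speed by (auto simp: seg a_def b_def)
    let ?I = "integral {a..b} (\<lambda>r. 1 / top_rate r)"
    note times = min_times_if_top_rate_pos[OF top_pos, folded a_def b_def]
    show "min_time F B C y\<^sub>0 y\<^sub>1 = reduced_min_time F B C y\<^sub>0 y\<^sub>1" "min_time F B C y\<^sub>0 y\<^sub>1 < \<infinity>"
      using times by simp_all
    define g where "g r = 1 / speed F B C (h\<^sub>0 + r *\<^sub>R e) h\<^sub>0 h\<^sub>1" for r
    have g: "g r = 1 / top_rate (r + a)" if "r \<in> {0..b - a}" for r
      using speed[of "r + a"] that by (simp add: g_def h algebra_simps)
    have cont: "continuous_on {a..b} (\<lambda>r. 1 / top_rate r)"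
      using continuous_inverse_top_rate[OF top_pos] by (simp add: a_def b_def)
    have "continuous_on {0..b - a} (\<lambda>r. 1 / top_rate (r + a))"
      by (rule continuous_on_compose2[OF cont]) (auto intro!: continuous_intros)
    then have "continuous_on {0..b - a} g" by (rule continuous_on_eq) (simp add: g)
    then have int: "set_integrable lborel {0..b - a} g" by (rule borel_integrable_atLeastAtMost')
    then show "arclength_integrable h\<^sub>0 h\<^sub>1 (\<lambda>h. 1 / speed F B C h h\<^sub>0 h\<^sub>1)"
      by (simp add: arclength_integrable_def len dir g_def[abs_def])
    have "arclength_integral h\<^sub>0 h\<^sub>1 (\<lambda>h. 1 / speed F B C h h\<^sub>0 h\<^sub>1) = integral {0..b - a} g"
      using set_borel_integral_eq_integral(2)[OF int] by (simp add: arclength_integral_def len dir g_def[abs_def])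
    also have "\<dots> = integral {a - a..b - a} (\<lambda>r. 1 / top_rate (r + a))"
      unfolding diff_self by (rule integral_cong) (rule g)
    also have "\<dots> = ?I" by (rule integral_shift_real_ivl)
    finally show "min_time F B C y\<^sub>0 y\<^sub>1 = ereal (arclength_integral h\<^sub>0 h\<^sub>1 (\<lambda>h. 1 / speed F B C h h\<^sub>0 h\<^sub>1))"
      using times by simp
  next
    assume "\<exists>h\<^sub>2\<in>closed_segment h\<^sub>0 h\<^sub>1. speed F B C h\<^sub>2 h\<^sub>0 h\<^sub>1 \<le> 0"
    then obtain r where "r \<in> {y\<^sub>0 \<bullet> e..y\<^sub>1 \<bullet> e}" "top_rate r \<le> 0"
      using speed by (auto simp: seg a_def b_def)
    from min_times_if_top_rate_nonpos[OF this]
    show "min_time F B C y\<^sub>0 y\<^sub>1 = \<infinity>" "reduced_min_time F B C y\<^sub>0 y\<^sub>1 = \<infinity>" .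
  qed
qed

end
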